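(* Let $f:\mathcal X\to\mathbb R^k$ be arbitrary with $P_0|f|^2<\infty$, and let $od(p)=(1-p)/p$. When $J=2$ (and $od(p^{(1)})+od(p^{(2)})>0$), the optimal weight function $\rho$ that minimizes the asymptotic variance of $\mathbb G_N^{\mathrm{H,Ber}}f$ has $$c^{(1)}=\frac{od(p^{(2)})}{od(p^{(1)})+od(p^{(2)})},\qquad c^{(2)}=\frac{od(p^{(1)})}{od(p^{(1)})+od(p^{(2)})}.$$ When $J\ge2$, the optimal weight function $\rho$ that minimizes the asymptotic variance of $\mathbb G_N^{\mathrm{H,Ber}}f$ has (1) $c^{(j)}_{k_1,\dots,k_l}=0$ if $p^{(j)}<1$ and $p^{(k_m)}=1$ for some $m$; (2) arbitrary $c^{(j)}_{k_1,\dots,k_l}$ if $p^{(j)}=1$ (subject to the constraint $\sum_{j}\rho^{(j)}(v)=1$); (3) if $p^{(j)}<1$ and $p^{(k_m)}<1$ for all $m=1,\dots,l$, $$c^{(j)}_{k_1,\dots,k_l}=\frac{\prod_{m=1}^l od(p^{(k_m)})}{\prod_{m=1}^l od(p^{(k_m)})+od(p^{(j)})\sum_{n=1}^l\prod_{m=1}^l od(p^{(k_m)})/od(p^{(k_n)})}.$$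
   Context: Setting. $X$ takes values in a measurable space $(\mathcal{X},\mathcal{A})$ and has law $P_0$. $U\in\mathcal U$ is a vector of auxiliary variables, $W=(X,U)\in\mathcal W=\mathcal X\times\mathcal U$ has law $\tilde P_0$, and $V=(\check X,U)\in\mathcal V$, where $\check X$ is a coarsening (measurable function) of $X$. The space $\mathcal V=\bigcup_{j=1}^J\mathcal V^{(j)}$ is a union of $J$ measurable, possibly overlapping data sources. $\nu^{(j)}=\tilde P_0(V\in\mathcal V^{(j)})$ and $P_0^{(j)}$ is the conditional law of $W$ given $V\in\mathcal V^{(j)}$. Bernoulli sampling. $W_1,\dots,W_N$ are i.i.d. copies of $W$ with corresponding $X_i,V_i$. For each source $j$, conditionally on the data, the selection indicators $R_i^{(j)}$ of units with $V_i\in\mathcal V^{(j)}$ are i.i.d. Bernoulli$(p^{(j)})$, $p^{(j)}\in(0,1]$; $R_i^{(j)}=0$ if $V_i\notin\mathcal V^{(j)}$; samplings from different sources are conditionally independent. $\pi^{(j)}(V_i)=p^{(j)}I\{V_i\in\mathcal V^{(j)}\}$, convention $0/0=0$. Weight functions. The minimization is over functions $\rho=(\rho^{(1)},\dots,\rho^{(J)}):\mathcal V\to[0,1]^J$ with $\sum_{j=1}^J\rho^{(j)}(v)=1$ for all $v$ of the following form: $\rho^{(j)}(v)=0$ if $v\notin\mathcal V^{(j)}$; $\rho^{(j)}(v)=1$ if $v\in\mathcal V^{(j)}$ and $v$ belongs to no other source; and, for $j,k_1,\dots,k_l$ all different, $\rho^{(j)}(v)=c^{(j)}_{k_1,\dots,k_l}$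 (a constant) if $v$ belongs to exactly the sources $\mathcal V^{(j)},\mathcal V^{(k_1)},\dots,\mathcal V^{(k_l)}$. When $J=2$ the constants on $\mathcal V^{(1)}\cap\mathcal V^{(2)}$ are written $\rho=(c^{(1)},c^{(2)})$, with $c^{(1)}+c^{(2)}=1$. $\mathbb G_N^{\mathrm{H,Ber}}f=\sqrt N\Big(\frac1N\sum_{i=1}^N\sum_{j=1}^J\frac{R_i^{(j)}\rho^{(j)}(V_i)}{\pi^{(j)}(V_i)}f(X_i)-P_0f\Big)$. Its asymptotic variance (the covariance matrix of its normal limit as $N\to\infty$) is $$\mathrm{Var}_0\{f(X)\}+\sum_{j=1}^J\nu^{(j)}\frac{1-p^{(j)}}{p^{(j)}}P_0^{(j)}\{(\rho^{(j)})^2ff^T\},$$ where $\mathrm{Var}_0$ is variance under $P_0$; for $k>1$ minimization is in the positive semidefinite order. *)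

theory Defs
  imports "HOL-Probability.Probability"
begin

section \<open>Asymptotic variance of a sequence of random vectors\<close>

definition converges_in_distribution :: "(nat \<Rightarrow> 'b::real_normed_vector measure) \<Rightarrow> 'b measure \<Rightarrow> bool"
  where "converges_in_distribution \<mu>s \<mu> \<longleftrightarrow>
    (\<forall>g :: 'b \<Rightarrow> real. continuous_on UNIV g \<longrightarrow> bounded (range g) \<longrightarrow>
      (\<lambda>n. \<integral>x. g x \<partial>\<mu>s n) \<longlonglongrightarrow> (\<integral>x. g x \<partial>\<mu>))"

text \<open>The case \<open>s = 0\<close> is the point mass, so that singular covariance matrices are allowed.\<close>

definition normal_law :: "real \<Rightarrow> real \<Rightarrow> real measure"
  where "normal_law m s =
    (if s = 0 then return borel m else density lborel (normal_density m s))"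

definition multivariate_normal :: "(real ^ 'k) measure \<Rightarrow> bool"
  where "multivariate_normal \<mu> \<longleftrightarrow> prob_space \<mu> \<and> sets \<mu> = sets borel \<and>
    (\<forall>t. \<exists>m s. 0 \<le> s \<and> distr \<mu> borel (\<lambda>x. t \<bullet> x) = normal_law m s)"

definition covariance_matrix :: "(real ^ 'k) measure \<Rightarrow> real ^ 'k ^ 'k"
  where "covariance_matrix \<mu> =
    (\<chi> a b. (\<integral>x. x $ a * x $ b \<partial>\<mu>) - (\<integral>x. x $ a \<partial>\<mu>) * (\<integral>x. x $ b \<partial>\<mu>))"

definition asymptotic_variance :: "'s measure \<Rightarrow> (nat \<Rightarrow> 's \<Rightarrow> real ^ 'k) \<Rightarrow> real ^ 'k ^ 'k"
  where "asymptotic_variance M Z =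
    (THE \<Sigma>. \<exists>\<mu>. multivariate_normal \<mu> \<and>
      converges_in_distribution (\<lambda>n. distr M borel (Z n)) \<mu> \<and> \<Sigma> = covariance_matrix \<mu>)"

definition psd :: "real ^ 'k ^ 'k \<Rightarrow> bool"
  where "psd A \<longleftrightarrow> transpose A = A \<and> (\<forall>x. 0 \<le> x \<bullet> (A *v x))"

definition psd_le :: "real ^ 'k ^ 'k \<Rightarrow> real ^ 'k ^ 'k \<Rightarrow> bool"
  where "psd_le A B \<longleftrightarrow> psd (B - A)"

section \<open>Overlapping data sources and Bernoulli sampling\<close>

definition obs :: "('x \<Rightarrow> 'c) \<Rightarrow> 'x \<times> 'u \<Rightarrow> 'c \<times> 'u"
  where "obs coarse w = (coarse (fst w), snd w)"

definition sources_of :: "nat \<Rightarrow> (nat \<Rightarrow> 'v set) \<Rightarrow> 'v \<Rightarrow> nat set"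
  where "sources_of J Vs v = {j \<in> {1..J}. v \<in> Vs j}"

text \<open>
  Sources are numbered \<open>1, \<dots>, J\<close>, and units are numbered from \<open>0\<close>: the sample of size \<open>N\<close>
  consists of the units \<open>i < N\<close>. \<open>W i\<close> is the pair (variable of interest, auxiliary variables)
  of unit \<open>i\<close>, with law \<open>Pt\<close>, and \<open>R i j\<close> says whether unit \<open>i\<close> is selected from source \<open>j\<close>.
  The last assumption gives the joint conditional probability mass function of all selection
  indicators of the sample, given the sigma-algebra generated by the data \<open>W 0, \<dots>, W (N - 1)\<close>.
\<close>

locale multisource_bernoulli_sampling = prob_space M
  for M :: "'s measure" +
  fixes XM :: "'x measure" and UM :: "'u measure" and CM :: "'c measure"
    and coarse :: "'x \<Rightarrow> 'c"
    and J :: nat and Vs :: "nat \<Rightarrow> ('c \<times> 'u) set"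
    and Pt :: "('x \<times> 'u) measure"
    and p :: "nat \<Rightarrow> real"
    and W :: "nat \<Rightarrow> 's \<Rightarrow> 'x \<times> 'u"
    and R :: "nat \<Rightarrow> nat \<Rightarrow> 's \<Rightarrow> bool"
  assumes coarse: "coarse \<in> measurable XM CM"
    and source_sets: "\<And>j. j \<in> {1..J} \<Longrightarrow> Vs j \<in> sets (CM \<Otimes>\<^sub>M UM)"
    and source_cover: "\<And>w. w \<in> space (XM \<Otimes>\<^sub>M UM) \<Longrightarrow> obs coarse w \<in> (\<Union>j\<in>{1..J}. Vs j)"
    and data_indep: "indep_vars (\<lambda>_. XM \<Otimes>\<^sub>M UM) W UNIV"
    and data_law: "\<And>i. distr M (XM \<Otimes>\<^sub>M UM) (W i) = Pt"
    and p_range: "\<And>j. j \<in> {1..J} \<Longrightarrow> 0 < p j \<and> p j \<le> 1"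
    and R_measurable: "\<And>i j. j \<in> {1..J} \<Longrightarrow> R i j \<in> measurable M (count_space UNIV)"
    and bernoulli_selection: "\<And>N r. AE \<omega> in M.
      real_cond_exp M
        (vimage_algebra (space M) (\<lambda>\<omega>. \<lambda>i\<in>{..<N}. W i \<omega>) (\<Pi>\<^sub>M i\<in>{..<N}. XM \<Otimes>\<^sub>M UM))
        (indicator {\<omega> \<in> space M. \<forall>i<N. \<forall>j\<in>{1..J}. R i j \<omega> = r i j}) \<omega>
      = (\<Prod>i<N. \<Prod>j\<in>{1..J}.
          pmf (if obs coarse (W i \<omega>) \<in> Vs j then bernoulli_pmf (p j) else return_pmf False) (r i j))"

definition inclusion_prob :: "(nat \<Rightarrow> 'v set) \<Rightarrow> (nat \<Rightarrow> real) \<Rightarrow> nat \<Rightarrow> 'v \<Rightarrow> real"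
  where "inclusion_prob Vs p j v = p j * indicator (Vs j) v"

text \<open>The convention \<open>0/0 = 0\<close> is that of division in HOL. \<open>P0\<close> is the law of \<open>X\<close>.\<close>

definition G_HBer ::
  "('x \<Rightarrow> 'c) \<Rightarrow> nat \<Rightarrow> (nat \<Rightarrow> ('c \<times> 'u) set) \<Rightarrow> (nat \<Rightarrow> real) \<Rightarrow> 'x measure \<Rightarrow>
   (nat \<Rightarrow> 's \<Rightarrow> 'x \<times> 'u) \<Rightarrow> (nat \<Rightarrow> nat \<Rightarrow> 's \<Rightarrow> bool) \<Rightarrow> ('x \<Rightarrow> real ^ 'k) \<Rightarrow>
   (nat \<Rightarrow> 'c \<times> 'u \<Rightarrow> real) \<Rightarrow> nat \<Rightarrow> 's \<Rightarrow> real ^ 'k"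
  where "G_HBer coarse J Vs p P0 W R f \<rho> N \<omega> =
    sqrt (real N) *\<^sub>R
      ((1 / real N) *\<^sub>R
        (\<Sum>i<N. \<Sum>j\<in>{1..J}.
          (of_bool (R i j \<omega>) * \<rho> j (obs coarse (W i \<omega>)) /
            inclusion_prob Vs p j (obs coarse (W i \<omega>))) *\<^sub>R f (fst (W i \<omega>)))
       - (\<integral>x. f x \<partial>P0))"

section \<open>Weight functions\<close>

text \<open>
  The constant \<open>c\<^sup>(\<^sup>j\<^sup>)\<close> with subscripts \<open>k\<^sub>1, \<dots>, k\<^sub>l\<close> (all different, and different from \<open>j\<close>) is
  \<open>c j K\<close> for the nonempty set \<open>K = {k\<^sub>1, \<dots>, k\<^sub>l}\<close>: it depends on the subscripts only through this
  set. Values \<open>\<rho> j v\<close> for \<open>v\<close> outside the union of the sources are irrelevant and not constrained.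
\<close>

definition weight_function_with ::
  "nat \<Rightarrow> (nat \<Rightarrow> 'v set) \<Rightarrow> (nat \<Rightarrow> nat set \<Rightarrow> real) \<Rightarrow> (nat \<Rightarrow> 'v \<Rightarrow> real) \<Rightarrow> bool"
  where "weight_function_with J Vs c \<rho> \<longleftrightarrow>
    (\<forall>v \<in> (\<Union>j\<in>{1..J}. Vs j).
      (\<forall>j\<in>{1..J}. 0 \<le> \<rho> j v \<and> \<rho> j v \<le> 1) \<and>
      (\<Sum>j\<in>{1..J}. \<rho> j v) = 1 \<and>
      (\<forall>j\<in>{1..J}.
        (v \<notin> Vs j \<longrightarrow> \<rho> j v = 0) \<and>
        (sources_of J Vs v = {j} \<longrightarrow> \<rho> j v = 1) \<and>
        (\<forall>K. K \<noteq> {} \<and> K \<subseteq> {1..J} - {j} \<and> sources_of J Vs v = insert j K \<longrightarrow> \<rho> j v = c j K)))"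

definition weight_function :: "nat \<Rightarrow> (nat \<Rightarrow> 'v set) \<Rightarrow> (nat \<Rightarrow> 'v \<Rightarrow> real) \<Rightarrow> bool"
  where "weight_function J Vs \<rho> \<longleftrightarrow> (\<exists>c. weight_function_with J Vs c \<rho>)"

definition minimizes_asymptotic_variance ::
  "'s measure \<Rightarrow> nat \<Rightarrow> (nat \<Rightarrow> 'v set) \<Rightarrow>
   ((nat \<Rightarrow> 'v \<Rightarrow> real) \<Rightarrow> nat \<Rightarrow> 's \<Rightarrow> real ^ 'k) \<Rightarrow> (nat \<Rightarrow> 'v \<Rightarrow> real) \<Rightarrow> bool"
  where "minimizes_asymptotic_variance M J Vs G \<rho> \<longleftrightarrow>
    weight_function J Vs \<rho> \<and>
    (\<forall>\<rho>'. weight_function J Vs \<rho>' \<longrightarrow>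
      psd_le (asymptotic_variance M (G \<rho>)) (asymptotic_variance M (G \<rho>')))"

definition od :: "real \<Rightarrow> real"
  where "od q = (1 - q) / q"

text \<open>
  If \<open>f (X)\<close> vanishes almost surely on the event that \<open>V\<close> lies in exactly the sources in \<open>S\<close> (for
  instance if this event has probability zero), then the constants attached to \<open>S\<close> do not affect
  the asymptotic variance; the overlap \<open>S\<close> is relevant otherwise.
\<close>

definition relevant_overlap ::
  "('x \<Rightarrow> 'c) \<Rightarrow> nat \<Rightarrow> (nat \<Rightarrow> ('c \<times> 'u) set) \<Rightarrow> ('x \<times> 'u) measure \<Rightarrow> ('x \<Rightarrow> real ^ 'k) \<Rightarrow>
   nat set \<Rightarrow> bool"
  where "relevant_overlap coarse J Vs Pt f S \<longleftrightarrow>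
    \<not> (AE w in Pt. sources_of J Vs (obs coarse w) = S \<longrightarrow> f (fst w) = 0)"

end

theory Submission
  imports Defs
begin

text \<open>
  Write \<open>Y\<close> for the inverse-probability weighted contribution of one unit. Conditionally on the
  data the selection indicators of distinct units are independent, so the contributions are i.i.d.,
  and averaging over the Bernoulli selections gives \<open>E Y = P0 f\<close> and
  \<open>E Y Y\<^sup>T = E (f f\<^sup>T (1 + D))\<close> with \<open>D = \<Sum>\<^sub>j od (p j) (\<rho> j)\<^sup>2\<close>. The multivariate central limit theorem
  (characteristic functions of projections, with the uniform second moment bound supplying
  tightness) turns the covariance matrix of \<open>Y\<close> into the asymptotic variance.

  On units that lie in exactly the sources \<open>S\<close>, \<open>D\<close> is a weighted sum of squares of numbers that sum
  to one. Its minimizer \<open>c\<close> makes \<open>od (p j) c j\<close> constant in \<open>j\<close>, so that \<open>D\<close> exceeds its minimum by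
  \<open>\<Sum>\<^sub>j od (p j) (\<rho> j - c j)\<^sup>2\<close>. Hence the minimizer is optimal in the positive semidefinite order,
  simultaneously for all \<open>S\<close>, and a weight function is optimal iff this excess vanishes almost
  surely where \<open>f\<close> does not.
\<close>

section \<open>Convergence in distribution from characteristic functions\<close>

text \<open>\<open>asymptotic_variance\<close> is a definite description over normal limits, so
  evaluating it needs a limit law that exists and is unique. The covariance may be singular, which
  rules out a density: the law is assembled from one-dimensional normals, and the point mass counts
  as normal. \<open>converges_in_distribution\<close> quantifies over bounded continuous functions
  on the whole space, while the one-dimensional central limit theorem speaks of projections only;
  hence the trigonometric polynomials. The sampling assumption only says how finitely many
  indicators are distributed given an initial segment of the data, so independence of the units has
  to be summed out of it. A weight function is not assumed measurable, but on the data it depends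
  only on the set of sources that contain the unit. That set takes finitely many values, which gives
  measurability, boundedness and integrability at once. Optimality cannot pin down constants on
  overlaps that \<open>f\<close> does not see; the criterion is therefore stated for relevant
  overlaps.\<close>

inductive trig_poly :: "('a::euclidean_space \<Rightarrow> real) \<Rightarrow> bool" where
  trig_poly_cos: "trig_poly (\<lambda>x. a * cos (t \<bullet> x + u))"
| trig_poly_add: "trig_poly g \<Longrightarrow> trig_poly h \<Longrightarrow> trig_poly (\<lambda>x. g x + h x)"

lemma trig_poly_const: "trig_poly (\<lambda>_. c)"
  using trig_poly_cos[of c 0 0] by simp

text \<open>Product-to-sum formula. The phase \<open>u\<close> in the generators makes sines
  available as shifted cosines, so real coefficients suffice for an algebra, as Stone--Weierstrass
  requires.\<close>

lemma trig_poly_mult: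
  assumes "trig_poly g" "trig_poly h"
  shows "trig_poly (\<lambda>x. g x * h x)"
  using assms(1)
proof induction
  case (trig_poly_cos a t u)
  show ?case using assms(2)
  proof induction
    case (trig_poly_cos b s v)
    have "(\<lambda>x. a * cos (t \<bullet> x + u) * (b * cos (s \<bullet> x + v))) =
      (\<lambda>x. a * b / 2 * cos ((t - s) \<bullet> x + (u - v)) + a * b / 2 * cos ((t + s) \<bullet> x + (u + v)))"
    proof
      fix x
      have "cos ((t - s) \<bullet> x + (u - v)) = cos ((t \<bullet> x + u) - (s \<bullet> x + v))"
        "cos ((t + s) \<bullet> x + (u + v)) = cos ((t \<bullet> x + u) + (s \<bullet> x + v))"
        by (simp_all add: inner_diff_left inner_add_left algebra_simps)
      then show "a * cos (t \<bullet> x + u) * (b * cos (s \<bullet> x + v)) =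
          a * b / 2 * cos ((t - s) \<bullet> x + (u - v)) + a * b / 2 * cos ((t + s) \<bullet> x + (u + v))"
        by (simp only: cos_diff cos_add) (simp add: field_simps)
    qed
    then show ?case
      by (simp only:) (intro trig_poly.intros)
  next
    case (trig_poly_add g h)
    then show ?case unfolding distrib_left by (intro trig_poly.trig_poly_add)
  qed
next
  case (trig_poly_add g h')
  then show ?case unfolding distrib_right by (intro trig_poly.trig_poly_add)
qed

lemma trig_poly_continuous: "trig_poly h \<Longrightarrow> continuous_on UNIV h"
  by (induction rule: trig_poly.induct) (auto intro!: continuous_intros)

lemma trig_poly_bounded: "trig_poly h \<Longrightarrow> \<exists>C>0. \<forall>x. \<bar>h x\<bar> \<le> C"
proof (induction rule: trig_poly.induct)
  case (trig_poly_cos a t u)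
  \<comment> \<open>The added 1 keeps the bound strictly positive when \<open>a = 0\<close>.\<close>
  have "\<bar>a * cos (t \<bullet> x + u)\<bar> \<le> \<bar>a\<bar> + 1" for x
    using mult_left_le[of "\<bar>cos (t \<bullet> x + u)\<bar>" "\<bar>a\<bar>"] by (simp add: abs_mult)
  then show ?case by (intro exI[of _ "\<bar>a\<bar> + 1"]) auto
next
  case (trig_poly_add g h)
  then obtain C D where "C > 0" "D > 0" "\<And>x. \<bar>g x\<bar> \<le> C" "\<And>x. \<bar>h x\<bar> \<le> D" by auto
  then have "\<bar>g x + h x\<bar> \<le> C + D" for x
    by (intro order.trans[OF abs_triangle_ineq] add_mono)
  with \<open>C > 0\<close> \<open>D > 0\<close> show ?case by (intro exI[of _ "C + D"]) auto
qed

lemma trig_poly_separates: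
  fixes x y :: "'a::euclidean_space"
  assumes "x \<noteq> y"
  shows "\<exists>h. trig_poly h \<and> h x \<noteq> h y"
proof -
  \<comment> \<open>This scaling makes the phases at \<open>x\<close> and \<open>y\<close> differ by
    exactly pi; after a shift by \<open>t \<bullet> y\<close> the cosine is -1 at \<open>x\<close>
    and 1 at \<open>y\<close>.\<close>
  define t where "t = (pi / (norm (x - y))\<^sup>2) *\<^sub>R (x - y)"
  have "t \<bullet> x - t \<bullet> y = t \<bullet> (x - y)" by (simp only: inner_diff_right)
  also have "\<dots> = pi"
    using assms by (simp add: t_def dot_square_norm)
  finally have "t \<bullet> x - t \<bullet> y = pi" .
  then have "1 * cos (t \<bullet> x + - (t \<bullet> y)) \<noteq> 1 * cos (t \<bullet> y + - (t \<bullet> y))"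
    by simp
  then show ?thesis using trig_poly_cos[of 1 t "- (t \<bullet> y)"] by blast
qed

lemma trig_poly_compose_polynomial:
  assumes "real_polynomial_function (q :: real \<Rightarrow> real)" "trig_poly h"
  shows "trig_poly (\<lambda>x. q (h x))"
  using assms(1)
proof induction
  case (linear q)
  have "q y = q 1 * y" for y
    using linear_scale[OF bounded_linear.linear[OF linear], of y 1] by (simp add: mult.commute)
  then have "(\<lambda>x. q (h x)) = (\<lambda>x. q 1 * h x)" by (rule ext)
  moreover have "trig_poly (\<lambda>x. q 1 * h x)"
    by (intro trig_poly_mult trig_poly_const assms)
  ultimately show ?case by (simp only:)
qed (auto intro: trig_poly_const trig_poly_add trig_poly_mult)

text \<open>Stone--Weierstrass gives no control away from a ball. Composing the approximation with a
  polynomial that imitates truncation at the bound of \<open>g\<close> keeps it a trigonometric polynomial and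
  bounds it everywhere.\<close>

lemma trig_poly_approximation:
  fixes g :: "'a::euclidean_space \<Rightarrow> real"
  assumes g: "continuous_on UNIV g" "bounded (range g)" and e: "e > 0"
  obtains h where "trig_poly h" "\<And>x. \<bar>g x - h x\<bar> \<le> e * (1 + (norm x)\<^sup>2)"
proof -
  obtain B where B: "B > 0" "\<And>x. \<bar>g x\<bar> \<le> B"
    using g(2) by (auto simp: bounded_pos)
  \<comment> \<open>Everywhere \<open>\<bar>g x - q (h x)\<bar>\<close> is at most
    \<open>2 * B + e\<close>. The radius is chosen so that the quadratic term
    \<open>e * T\<^sup>2\<close> has already reached this crude bound on the sphere.\<close>
  define T where "T = sqrt ((2 * B + e) / e)"
  have T: "0 \<le> T" "e * T\<^sup>2 = 2 * B + e" using B e by (auto simp: T_def)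
  have "\<exists>h. trig_poly h \<and> (\<forall>x\<in>cball 0 T. \<bar>g x - h x\<bar> < e / 2)"
  proof (rule Stone_Weierstrass_HOL)
    show "continuous_on (cball 0 T) g"
      using g(1) by (rule continuous_on_subset) simp
    show "continuous_on (cball 0 T) f" if "trig_poly f" for f :: "'a \<Rightarrow> real"
      using trig_poly_continuous[OF that] by (rule continuous_on_subset) simp
  qed (use e in \<open>auto intro: trig_poly_const trig_poly_add trig_poly_mult trig_poly_separates\<close>)
  then obtain h where h: "trig_poly h" "\<And>x. x \<in> cball 0 T \<Longrightarrow> \<bar>g x - h x\<bar> < e / 2" by auto
  obtain C where C: "\<And>x. \<bar>h x\<bar> \<le> C" using trig_poly_bounded[OF h(1)] by auto
  \<comment> \<open>Values of \<open>g\<close> lie in the interval from \<open>-B\<close> to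
    \<open>B\<close>, so clamping \<open>h x\<close> to it never increases the distance to
    \<open>g x\<close>. The polynomial \<open>q\<close> imitates \<open>clamp\<close> on the whole
    range of \<open>h\<close>, not only on its values over the ball.\<close>
  define clamp where "clamp y = max (- B) (min B y)" for y :: real
  obtain q where q: "real_polynomial_function q" "\<And>y. y \<in> {-C..C} \<Longrightarrow> \<bar>clamp y - q y\<bar> < e / 2"
    by (rule Stone_Weierstrass_real_polynomial_function[of "{-C..C}" clamp "e / 2"])
      (use e in \<open>auto simp: clamp_def intro!: continuous_intros\<close>)
  have q': "\<bar>clamp (h x) - q (h x)\<bar> < e / 2" for x
    using C[of x] by (intro q) auto
  show thesis
  proof
    show "trig_poly (\<lambda>x. q (h x))" by (rule trig_poly_compose_polynomial) fact+
    fix x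
    show "\<bar>g x - q (h x)\<bar> \<le> e * (1 + (norm x)\<^sup>2)"
    proof (cases "norm x \<le> T")
      case True
      then have "\<bar>g x - h x\<bar> < e / 2" by (intro h) auto
      then have "\<bar>g x - q (h x)\<bar> \<le> e"
        using q'[of x] B(2)[of x] unfolding clamp_def by linarith
      also have "e \<le> e * (1 + (norm x)\<^sup>2)" using e by (simp add: algebra_simps)
      finally show ?thesis .
    next
      case False
      have "\<bar>g x - q (h x)\<bar> \<le> 2 * B + e"
        using q'[of x] B(1) B(2)[of x] unfolding clamp_def by linarith
      also have "\<dots> \<le> e * (norm x)\<^sup>2"
        unfolding T(2)[symmetric] using False T e by (intro mult_left_mono power_mono) auto
      also have "\<dots> \<le> e * (1 + (norm x)\<^sup>2)" using e by (simp add: algebra_simps)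
      finally show ?thesis .
    qed
  qed
qed

section \<open>From characteristic functions to bounded continuous test functions\<close>

lemma trig_poly_measurable: "trig_poly h \<Longrightarrow> h \<in> borel_measurable borel"
  by (intro borel_measurable_continuous_onI trig_poly_continuous)

lemma trig_poly_integrable:
  assumes "prob_space \<mu>" "sets \<mu> = sets borel" "trig_poly h"
  shows "integrable \<mu> h"
proof -
  interpret prob_space \<mu> by fact
  obtain C where "\<And>x. \<bar>h x\<bar> \<le> C" using trig_poly_bounded[OF assms(3)] by auto
  moreover have "h \<in> borel_measurable \<mu>"
    using trig_poly_measurable[OF assms(3)] assms(2) by (simp cong: measurable_cong_sets)
  ultimately show ?thesis by (intro integrable_const_bound[of _ C]) auto
qed

lemma integrable_iexp_inner:
  fixes t :: "'a::euclidean_space"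
  assumes "prob_space \<mu>" "sets \<mu> = sets borel"
  shows "integrable \<mu> (\<lambda>x. iexp (t \<bullet> x))"
proof -
  interpret prob_space \<mu> by fact
  have "(\<lambda>x. iexp (t \<bullet> x)) \<in> borel_measurable borel"
    by (intro borel_measurable_continuous_onI continuous_intros)
  then show ?thesis
    using assms(2) by (intro integrable_const_bound[of _ 1]) (auto cong: measurable_cong_sets)
qed

text \<open>Integrals of trigonometric polynomials are linear in the characteristic function, hence
  converge. The approximation error \<open>e * (1 + (norm x)\<^sup>2)\<close> integrates to at most
  \<open>e * (1 + D)\<close> under all the laws at once, so no compact set has to be chosen for each
  of them.\<close>

lemma converges_in_distribution_characteristic_function:
  fixes \<mu> :: "'a::euclidean_space measure"
  assumes \<mu>s: "\<And>n. prob_space (\<mu>s n)" "\<And>n. sets (\<mu>s n) = sets borel"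
    and \<mu>: "prob_space \<mu>" "sets \<mu> = sets borel"
    and moments: "\<And>n. integrable (\<mu>s n) (\<lambda>x. (norm x)\<^sup>2)" "\<And>n. (\<integral>x. (norm x)\<^sup>2 \<partial>\<mu>s n) \<le> C"
      "integrable \<mu> (\<lambda>x. (norm x)\<^sup>2)"
    and conv: "\<And>t. (\<lambda>n. \<integral>x. iexp (t \<bullet> x) \<partial>\<mu>s n) \<longlonglongrightarrow> (\<integral>x. iexp (t \<bullet> x) \<partial>\<mu>)"
  shows "converges_in_distribution \<mu>s \<mu>"
  unfolding converges_in_distribution_def
proof (intro allI impI)
  fix g :: "'a \<Rightarrow> real"
  assume g: "continuous_on UNIV g" "bounded (range g)"
  \<comment> \<open>A common bound for the second moments of the sequence and of the limit; the
    maximum with 0 keeps \<open>1 + D\<close> positive.\<close>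
  define D where "D = max 0 (max C (\<integral>x. (norm x)\<^sup>2 \<partial>\<mu>))"
  have D: "D \<ge> 0" "C \<le> D" "(\<integral>x. (norm x)\<^sup>2 \<partial>\<mu>) \<le> D" by (auto simp: D_def)
  have lim: "(\<lambda>n. \<integral>x. h x \<partial>\<mu>s n) \<longlonglongrightarrow> (\<integral>x. h x \<partial>\<mu>)" if "trig_poly h" for h :: "'a \<Rightarrow> real"
    using that
  proof induction
    case (trig_poly_cos a t u)
    \<comment> \<open>As a real part, the integral of a generator is a continuous function of the
      characteristic function at the single frequency \<open>t\<close>.\<close>
    have eq: "(\<integral>x. a * cos (t \<bullet> x + u) \<partial>\<nu>) = Re (complex_of_real a * iexp u * (\<integral>x. iexp (t \<bullet> x) \<partial>\<nu>))"
      if "prob_space \<nu>" "sets \<nu> = sets borel" for \<nu> :: "'a measure"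
    proof -
      have "Re (complex_of_real a * iexp u * (\<integral>x. iexp (t \<bullet> x) \<partial>\<nu>)) =
          Re (\<integral>x. complex_of_real a * iexp u * iexp (t \<bullet> x) \<partial>\<nu>)"
        by simp
      also have "\<dots> = (\<integral>x. Re (complex_of_real a * iexp u * iexp (t \<bullet> x)) \<partial>\<nu>)"
        by (intro integral_Re[symmetric] integrable_mult_right integrable_iexp_inner that)
      also have "\<dots> = (\<integral>x. a * cos (t \<bullet> x + u) \<partial>\<nu>)"
        by (intro Bochner_Integration.integral_cong refl)
          (simp add: exp_Euler cos_add Re_exp Im_exp algebra_simps cos_of_real sin_of_real)
      finally show ?thesis by simp
    qed
    show ?case
      unfolding eq[OF \<mu>s] eq[OF \<mu>] by (intro tendsto_intros conv)
  next
    case (trig_poly_add g h)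
    have eq: "(\<integral>x. g x + h x \<partial>\<nu>) = (\<integral>x. g x \<partial>\<nu>) + (\<integral>x. h x \<partial>\<nu>)"
      if "prob_space \<nu>" "sets \<nu> = sets borel" for \<nu> :: "'a measure"
      using trig_poly_integrable[OF that] trig_poly_add by simp
    show ?case
      unfolding eq[OF \<mu>s] eq[OF \<mu>] by (intro tendsto_intros trig_poly_add)
  qed
  show "(\<lambda>n. \<integral>x. g x \<partial>\<mu>s n) \<longlonglongrightarrow> (\<integral>x. g x \<partial>\<mu>)"
  proof (rule LIMSEQ_I)
    fix r :: real assume r: "r > 0"
    \<comment> \<open>Approximation under \<open>\<mu>s n\<close>, approximation under
      \<open>\<mu>\<close>, and convergence for \<open>h\<close> cost \<open>r / 4\<close> each,
      which leaves room for the strict inequality.\<close>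
    define e where "e = r / (4 * (1 + D))"
    have e: "e > 0" using r D by (simp add: e_def)
    have "1 + D \<noteq> 0" using D by simp
    then have e': "e * (1 + D) = r / 4" by (simp add: e_def field_simps)
    obtain h where h: "trig_poly h" "\<And>x. \<bar>g x - h x\<bar> \<le> e * (1 + (norm x)\<^sup>2)"
      using trig_poly_approximation[OF g e] by blast
    have bound: "\<bar>(\<integral>x. g x \<partial>\<nu>) - (\<integral>x. h x \<partial>\<nu>)\<bar> \<le> r / 4"
      if \<nu>: "prob_space \<nu>" "sets \<nu> = sets borel"
        and m: "integrable \<nu> (\<lambda>x. (norm x)\<^sup>2)" "(\<integral>x. (norm x)\<^sup>2 \<partial>\<nu>) \<le> D" for \<nu> :: "'a measure"
    proof -
      interpret prob_space \<nu> by fact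
      obtain B where "\<And>x. \<bar>g x\<bar> \<le> B" using g(2) by (auto simp: bounded_pos)
      moreover have "g \<in> borel_measurable \<nu>"
        using borel_measurable_continuous_onI[OF g(1)] \<nu>(2) by (simp cong: measurable_cong_sets)
      ultimately have ig: "integrable \<nu> g" by (intro integrable_const_bound[of _ B]) auto
      note ih = trig_poly_integrable[OF \<nu> h(1)]
      have "\<bar>(\<integral>x. g x \<partial>\<nu>) - (\<integral>x. h x \<partial>\<nu>)\<bar> = \<bar>\<integral>x. g x - h x \<partial>\<nu>\<bar>"
        using ig ih by simp
      also have "\<dots> \<le> (\<integral>x. \<bar>g x - h x\<bar> \<partial>\<nu>)" by (rule integral_abs_bound)
      also have "\<dots> \<le> (\<integral>x. e * (1 + (norm x)\<^sup>2) \<partial>\<nu>)"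
        using ig ih m h(2) by (intro integral_mono) auto
      also have "\<dots> = e * (1 + (\<integral>x. (norm x)\<^sup>2 \<partial>\<nu>))"
        using m by (simp add: prob_space)
      also have "\<dots> \<le> e * (1 + D)" using e m by (intro mult_left_mono) auto
      finally show ?thesis using e' by simp
    qed
    obtain n0 where n0: "\<And>n. n \<ge> n0 \<Longrightarrow> norm ((\<integral>x. h x \<partial>\<mu>s n) - (\<integral>x. h x \<partial>\<mu>)) < r / 4"
      using LIMSEQ_D[OF lim[OF h(1)], of "r / 4"] r by auto
    show "\<exists>no. \<forall>n\<ge>no. norm ((\<integral>x. g x \<partial>\<mu>s n) - (\<integral>x. g x \<partial>\<mu>)) < r"
    proof (intro exI allI impI)
      fix n assume n: "n \<ge> n0"
      show "norm ((\<integral>x. g x \<partial>\<mu>s n) - (\<integral>x. g x \<partial>\<mu>)) < r"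
        using n0[OF n] bound[OF \<mu>s[of n] moments(1) order.trans[OF moments(2) D(2)]]
          bound[OF \<mu> moments(3) D(3)] r
        unfolding real_norm_def by linarith
    qed
  qed
qed

section \<open>Normal laws with a given covariance form\<close>

lemma linear_functional_inner_representation:
  fixes \<phi> :: "'a::euclidean_space \<Rightarrow> real"
  assumes "linear \<phi>"
  obtains a where "\<And>t. t \<bullet> a = \<phi> t"
proof
  fix t
  have "\<phi> t = \<phi> (\<Sum>b\<in>Basis. (t \<bullet> b) *\<^sub>R b)" by (simp add: euclidean_representation)
  also have "\<dots> = (\<Sum>b\<in>Basis. (t \<bullet> b) * \<phi> b)"
    using assms by (simp add: linear_sum linear_scale)
  finally show "t \<bullet> (\<Sum>b\<in>Basis. \<phi> b *\<^sub>R b) = \<phi> t"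
    by (simp add: inner_sum_right mult.commute)
qed

text \<open>By Fubini an independent normal multiple of a fixed vector contributes a separate
  factor, that of a covariance form of rank one. Such factors are the building blocks of the next
  construction.\<close>

lemma characteristic_function_add_normal:
  fixes \<mu> :: "'a::euclidean_space measure" and a :: 'a
  assumes \<mu>: "prob_space \<mu>" "sets \<mu> = sets borel"
  defines "\<nu> \<equiv> distr (\<mu> \<Otimes>\<^sub>M std_normal_distribution) borel (\<lambda>(x, z). x + z *\<^sub>R a)"
  shows "prob_space \<nu>" "sets \<nu> = sets borel"
    "(\<integral>x. iexp (t \<bullet> x) \<partial>\<nu>) = (\<integral>x. iexp (t \<bullet> x) \<partial>\<mu>) * exp (- (t \<bullet> a)\<^sup>2 / 2)"
proof -
  let ?N = std_normal_distribution
  interpret N: prob_space ?N by (rule prob_space_normal_density) simp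
  interpret P: prob_space \<mu> by fact
  interpret PN: pair_prob_space \<mu> ?N ..
  have [measurable_cong]: "sets \<mu> = sets borel" "sets ?N = sets borel" using \<mu> by auto
  have m[measurable]: "(\<lambda>(x, z). x + z *\<^sub>R a) \<in> borel_measurable (\<mu> \<Otimes>\<^sub>M ?N)"
    by measurable
  show "prob_space \<nu>" unfolding \<nu>_def by (rule PN.prob_space_distr) (rule m)
  show "sets \<nu> = sets borel" by (simp add: \<nu>_def)
  have mi: "(\<lambda>x. iexp (t \<bullet> x)) \<in> borel_measurable borel"
    by (intro borel_measurable_continuous_onI continuous_intros)
  have int: "integrable (\<mu> \<Otimes>\<^sub>M ?N) (\<lambda>p. iexp (t \<bullet> (case p of (x, z) \<Rightarrow> x + z *\<^sub>R a)))"
    using measurable_compose[OF m mi] by (intro PN.P.integrable_const_bound[of _ 1]) auto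
  have "(\<integral>x. iexp (t \<bullet> x) \<partial>\<nu>) = (\<integral>p. iexp (t \<bullet> (case p of (x, z) \<Rightarrow> x + z *\<^sub>R a)) \<partial>(\<mu> \<Otimes>\<^sub>M ?N))"
    unfolding \<nu>_def by (rule integral_distr[OF m mi])
  also have "\<dots> = (\<integral>x. \<integral>z. iexp (t \<bullet> (x + z *\<^sub>R a)) \<partial>?N \<partial>\<mu>)"
    using PN.integral_fst'[OF int] by simp
  also have "\<dots> = (\<integral>x. iexp (t \<bullet> x) * (\<integral>z. iexp ((t \<bullet> a) * z) \<partial>?N) \<partial>\<mu>)"
    by (intro Bochner_Integration.integral_cong refl)
      (simp add: inner_add_right ring_distribs exp_add mult.commute)
  also have "(\<integral>z. iexp ((t \<bullet> a) * z) \<partial>?N) = exp (- (t \<bullet> a)\<^sup>2 / 2)"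
    using char_std_normal_distribution by (simp add: char_def fun_eq_iff)
  finally show "(\<integral>x. iexp (t \<bullet> x) \<partial>\<nu>) = (\<integral>x. iexp (t \<bullet> x) \<partial>\<mu>) * exp (- (t \<bullet> a)\<^sup>2 / 2)"
    by simp
qed

text \<open>Each step of the induction splits off the rank-one part of the form in the direction \<open>b\<close>
  (a Schur complement) and realises it by an independent one-dimensional normal variable.\<close>

lemma gaussian_characteristic_function_exists:
  fixes Q :: "'a::euclidean_space \<Rightarrow> 'a \<Rightarrow> real"
  assumes "finite B" and "\<And>s. linear (Q s)" and "\<And>s t. Q s t = Q t s" and "\<And>t. 0 \<le> Q t t"
    and "\<And>b s. b \<in> Basis - B \<Longrightarrow> Q b s = 0"
  shows "\<exists>\<mu>. prob_space \<mu> \<and> sets \<mu> = sets borel \<and>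
    (\<forall>t. (\<integral>x. iexp (t \<bullet> x) \<partial>\<mu>) = complex_of_real (exp (- Q t t / 2)))"
  using assms
proof (induction B arbitrary: Q rule: finite_induct)
  \<comment> \<open>\<open>B\<close> holds the basis directions not yet eliminated. With none left
    the form is zero and the point mass at the origin realises it.\<close>
  case empty
  have "Q s t = 0" for s t
  proof -
    have "Q b t = 0" if "b \<in> Basis" for b t using empty(4) that by simp
    then have "Q t b = 0" if "b \<in> Basis" for b t using empty(2)[of t b] that by simp
    then show ?thesis
      using linear_eq_0_on_span[OF empty(1), of Basis] span_Basis by blast
  qed
  moreover have "prob_space (return borel 0 :: 'a measure)" by (rule prob_space_return) simp
  moreover have "(\<integral>x. iexp (t \<bullet> x) \<partial>return borel 0) = 1" for t :: 'a
    by (subst integral_return) (auto intro!: borel_measurable_continuous_onI continuous_intros)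
  ultimately show ?case by (intro exI[of _ "return borel 0"]) auto
next
  case (insert b B)
  note lin = insert.prems(1) and sym = insert.prems(2) and psd = insert.prems(3)
  have "(\<lambda>s. Q s t) = Q t" for t by (intro ext sym)
  then have lin': "linear (\<lambda>s. Q s t)" for t using lin by metis
  have expand: "Q (t - c *\<^sub>R b) (t - c *\<^sub>R b) = Q t t - 2 * c * Q b t + c\<^sup>2 * Q b b" for t c
    using sym[of t b]
    by (simp add: linear_diff[OF lin] linear_diff[OF lin'] linear_scale[OF lin] linear_scale[OF lin']
        power2_eq_square algebra_simps)
  show ?case
  proof (cases "Q b b = 0")
    case True
    have "Q b s = 0" for s
    proof (rule ccontr)
      assume "Q b s \<noteq> 0"
      \<comment> \<open>With \<open>Q b b = 0\<close> the form is affine along the line in direction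
        \<open>b\<close>; this multiple of \<open>b\<close> brings it to -1.\<close>
      then show False
        using psd[of "s - ((Q s s + 1) / (2 * Q b s)) *\<^sub>R b"]
        unfolding expand True by (simp add: field_simps)
    qed
    show ?thesis
    proof (rule insert.IH[of Q])
      show "Q c s = 0" if "c \<in> Basis - B" for c s
        using that insert.prems(4)[of c s] \<open>\<And>s. Q b s = 0\<close> by (cases "c = b") auto
    qed (fact lin sym psd)+
  next
    case False
    then have pos: "Q b b > 0" using psd[of b] by simp
    define Q' where "Q' s t = Q s t - Q b s * Q b t / Q b b" for s t
    have "\<exists>\<mu>. prob_space \<mu> \<and> sets \<mu> = sets borel \<and>
      (\<forall>t. (\<integral>x. iexp (t \<bullet> x) \<partial>\<mu>) = complex_of_real (exp (- Q' t t / 2)))"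
    proof (rule insert.IH[of Q'])
      show "linear (Q' s)" for s
        unfolding Q'_def
        by (intro linearI) (simp_all add: linear_add[OF lin] linear_scale[OF lin] algebra_simps add_divide_distrib)
      show "Q' s t = Q' t s" for s t unfolding Q'_def using sym[of s t] by simp
      \<comment> \<open>\<open>Q' t t\<close> is the minimum of the form on the line through
        \<open>t\<close> in direction \<open>b\<close>, attained at the multiple used here.\<close>
      show "0 \<le> Q' t t" for t
        using psd[of "t - (Q b t / Q b b) *\<^sub>R b"] pos
        unfolding expand Q'_def by (simp add: power2_eq_square field_simps)
      \<comment> \<open>The direction \<open>b\<close> has left the set, and subtracting the
        rank-one part makes \<open>Q'\<close> vanish there. For a direction \<open>c\<close>
        eliminated earlier, symmetry gives \<open>Q b c = 0\<close>, so the subtraction does not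
        disturb it.\<close>
      show "Q' c s = 0" if "c \<in> Basis - B" for c s
      proof (cases "c = b")
        case True
        then show ?thesis using pos by (simp add: Q'_def)
      next
        case False
        with that insert.prems(4)[of c] sym[of b c] show ?thesis by (simp add: Q'_def)
      qed
    qed
    then obtain \<mu> where \<mu>: "prob_space \<mu>" "sets \<mu> = sets borel"
        "\<And>t. (\<integral>x. iexp (t \<bullet> x) \<partial>\<mu>) = complex_of_real (exp (- Q' t t / 2))"
      by blast
    have "linear (\<lambda>t. Q b t / sqrt (Q b b))"
      by (intro linearI) (simp_all add: linear_add[OF lin] linear_scale[OF lin] add_divide_distrib)
    then obtain a where a: "\<And>t. t \<bullet> a = Q b t / sqrt (Q b b)"
      using linear_functional_inner_representation by blast
    have "- Q' t t / 2 + - (t \<bullet> a)\<^sup>2 / 2 = - Q t t / 2" for t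
      using pos by (simp add: a Q'_def power_divide power2_eq_square diff_divide_distrib)
    then have "(\<integral>x. iexp (t \<bullet> x) \<partial>distr (\<mu> \<Otimes>\<^sub>M std_normal_distribution) borel (\<lambda>(x, z). x + z *\<^sub>R a)) =
        complex_of_real (exp (- Q t t / 2))" for t
      unfolding characteristic_function_add_normal(3)[OF \<mu>(1,2)] \<mu>(3)
      by (simp only: of_real_mult[symmetric] exp_add[symmetric])
    then show ?thesis using characteristic_function_add_normal(1,2)[OF \<mu>(1,2)] by blast
  qed
qed

text \<open>As an image of the standard normal under scaling, the point mass \<open>s = 0\<close>
  needs no separate treatment in the moment and characteristic function computations.\<close>

lemma normal_law_eq_distr:
  assumes "0 \<le> s"
  shows "normal_law 0 s = distr std_normal_distribution borel (\<lambda>x. s * x)"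
proof (cases "s = 0")
  case True
  interpret N: prob_space std_normal_distribution by (rule prob_space_normal_density) simp
  show ?thesis
    using True N.distr_const[of 0 borel] by (simp add: normal_law_def)
next
  case False
  interpret N: prob_space std_normal_distribution by (rule prob_space_normal_density) simp
  have "distributed std_normal_distribution lborel (\<lambda>x. x) std_normal_density"
    by (auto simp: distributed_def distr_id2)
  from N.normal_density_affine[OF this, of s 0] False assms
  have "distributed std_normal_distribution lborel (\<lambda>x. s * x) (normal_density 0 s)" by simp
  then have "distr std_normal_distribution lborel (\<lambda>x. s * x) = density lborel (normal_density 0 s)"
    by (simp add: distributed_def)
  moreover have "distr std_normal_distribution lborel (\<lambda>x. s * x) = distr std_normal_distribution borel (\<lambda>x. s * x)"
    by (rule distr_cong) auto
  ultimately show ?thesis using False by (simp add: normal_law_def)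
qed

section \<open>Moments of normal laws and recovery of the covariance matrix\<close>

lemma
  assumes "0 \<le> s"
  shows real_distribution_normal_law: "real_distribution (normal_law 0 s)"
    and char_normal_law: "char (normal_law 0 s) t = complex_of_real (exp (- (s * t)\<^sup>2 / 2))"
    and integrable_normal_law: "integrable (normal_law 0 s) (\<lambda>x. x\<^sup>2)" "integrable (normal_law 0 s) (\<lambda>x. x)"
    and mean_normal_law: "(\<integral>x. x \<partial>normal_law 0 s) = 0"
    and second_moment_normal_law: "(\<integral>x. x\<^sup>2 \<partial>normal_law 0 s) = s\<^sup>2"
proof -
  interpret N: real_distribution std_normal_distribution by (rule real_dist_normal_dist)
  note eq = normal_law_eq_distr[OF assms]
  have m[measurable]: "(\<lambda>x. s * x) \<in> borel_measurable std_normal_distribution" by simp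
  show "real_distribution (normal_law 0 s)" unfolding eq by (rule N.real_distribution_distr) simp
  show "char (normal_law 0 s) t = complex_of_real (exp (- (s * t)\<^sup>2 / 2))"
  proof -
    have "char (normal_law 0 s) t = char std_normal_distribution (t * s)"
      unfolding eq char_def by (subst integral_distr) (simp_all add: mult.assoc)
    then show ?thesis by (simp only: char_std_normal_distribution mult.commute[of t s])
  qed
  have i: "integrable std_normal_distribution (\<lambda>x. (s * x)\<^sup>2)" "integrable std_normal_distribution (\<lambda>x. s * x)"
    using integrable_std_normal_distribution_moment[of 1] integrable_std_normal_distribution_moment[of 2]
    unfolding power_mult_distrib power_one_right by - (rule integrable_mult_right, assumption)+
  show "integrable (normal_law 0 s) (\<lambda>x. x\<^sup>2)" "integrable (normal_law 0 s) (\<lambda>x. x)"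
    unfolding eq by - (subst integrable_distr_eq; use i in simp)+
  have "(\<integral>x. x \<partial>normal_law 0 s) = (\<integral>x. s * x ^ 1 \<partial>std_normal_distribution)"
    unfolding eq by (subst integral_distr) simp_all
  also have "\<dots> = 0"
    using integral_std_normal_distribution_moment_odd[OF odd_one]
    by (simp only: integral_mult_right_zero mult_zero_right)
  finally show "(\<integral>x. x \<partial>normal_law 0 s) = 0" .
  have "(\<integral>x. x\<^sup>2 \<partial>normal_law 0 s) = (\<integral>x. s\<^sup>2 * x ^ (2 * 1) \<partial>std_normal_distribution)"
    unfolding eq by (subst integral_distr) (simp_all add: power_mult_distrib)
  also have "\<dots> = s\<^sup>2 * (fact (2 * 1) / (2 ^ 1 * fact 1))"
    by (simp only: integral_mult_right_zero std_normal_distribution_even_moments(1))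
  finally show "(\<integral>x. x\<^sup>2 \<partial>normal_law 0 s) = s\<^sup>2" by (simp add: fact_2)
qed

text \<open>The characteristic function of the projection at \<open>r\<close> is that of
  \<open>\<mu>\<close> at \<open>r *\<^sub>R t\<close>; homogeneity of \<open>q\<close> turns it
  into the one-dimensional normal one, and Levy uniqueness applies.\<close>

lemma projection_normal_law:
  fixes \<mu> :: "'a::euclidean_space measure"
  assumes "prob_space \<mu>" "sets \<mu> = sets borel"
    and char: "\<And>t. (\<integral>x. iexp (t \<bullet> x) \<partial>\<mu>) = complex_of_real (exp (- q t / 2))"
    and q: "\<And>t. 0 \<le> q t" "\<And>c t. q (c *\<^sub>R t) = c\<^sup>2 * q t"
  shows "distr \<mu> borel (\<lambda>x. t \<bullet> x) = normal_law 0 (sqrt (q t))"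
proof (rule Levy_uniqueness)
  interpret prob_space \<mu> by fact
  have [measurable_cong]: "sets \<mu> = sets borel" by fact
  show "real_distribution (distr \<mu> borel (\<lambda>x. t \<bullet> x))" by (rule real_distribution_distr) simp
  show "real_distribution (normal_law 0 (sqrt (q t)))" using q by (intro real_distribution_normal_law) simp
  show "char (distr \<mu> borel (\<lambda>x. t \<bullet> x)) = char (normal_law 0 (sqrt (q t)))"
  proof
    fix r
    have "char (distr \<mu> borel (\<lambda>x. t \<bullet> x)) r = (\<integral>x. iexp ((r *\<^sub>R t) \<bullet> x) \<partial>\<mu>)"
      unfolding char_def by (subst integral_distr) auto
    also have "\<dots> = char (normal_law 0 (sqrt (q t))) r"
      unfolding char using q by (simp add: char_normal_law power_mult_distrib mult.commute)
    finally show "char (distr \<mu> borel (\<lambda>x. t \<bullet> x)) r = char (normal_law 0 (sqrt (q t))) r" .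
  qed
qed

lemma projection_moments:
  fixes \<mu> :: "'a::euclidean_space measure"
  assumes sets: "sets \<mu> = sets borel"
    and eq: "distr \<mu> borel (\<lambda>x. t \<bullet> x) = normal_law 0 s" and "0 \<le> s"
  shows "integrable \<mu> (\<lambda>x. (t \<bullet> x)\<^sup>2)" "integrable \<mu> (\<lambda>x. t \<bullet> x)"
    "(\<integral>x. t \<bullet> x \<partial>\<mu>) = 0" "(\<integral>x. (t \<bullet> x)\<^sup>2 \<partial>\<mu>) = s\<^sup>2"
proof -
  have [measurable_cong]: "sets \<mu> = sets borel" by fact
  have m: "(\<lambda>x. t \<bullet> x) \<in> borel_measurable \<mu>" by simp
  note law = integrable_normal_law[OF \<open>0 \<le> s\<close>] mean_normal_law[OF \<open>0 \<le> s\<close>]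
    second_moment_normal_law[OF \<open>0 \<le> s\<close>]
  show "integrable \<mu> (\<lambda>x. (t \<bullet> x)\<^sup>2)" "integrable \<mu> (\<lambda>x. t \<bullet> x)"
    using law(1,2)[folded eq] by - (erule integrable_distr[OF m])+
  show "(\<integral>x. t \<bullet> x \<partial>\<mu>) = 0"
    using law(3)[folded eq] by (subst (asm) integral_distr[OF m]) simp_all
  show "(\<integral>x. (t \<bullet> x)\<^sup>2 \<partial>\<mu>) = s\<^sup>2"
    using law(4)[folded eq] by (subst (asm) integral_distr[OF m]) simp_all
qed

text \<open>Only second moments of projections are known, so mixed entries come from polarisation
  with the directions \<open>axis a 1\<close>, \<open>axis b 1\<close> and their sum.\<close>

lemma covariance_matrix_normal:
  fixes \<mu> :: "(real ^ 'k) measure" and Q :: "real ^ 'k \<Rightarrow> real ^ 'k \<Rightarrow> real"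
  assumes sets: "sets \<mu> = sets borel"
    and eq: "\<And>t. distr \<mu> borel (\<lambda>x. t \<bullet> x) = normal_law 0 (sqrt (Q t t))"
    and Q: "\<And>s. linear (Q s)" "\<And>s t. Q s t = Q t s" "\<And>t. 0 \<le> Q t t"
  shows "covariance_matrix \<mu> = (\<chi> a b. Q (axis a 1) (axis b 1))"
proof -
  have "(\<lambda>s. Q s t) = Q t" for t by (intro ext Q)
  then have lin: "linear (\<lambda>s. Q s t)" for t using Q(1) by metis
  note m = projection_moments[OF sets eq, simplified, OF Q(3)]
  have entry: "(\<integral>x. x $ a * x $ b \<partial>\<mu>) = Q (axis a 1) (axis b 1)" "(\<integral>x. x $ a \<partial>\<mu>) = 0" for a b
  proof -
    let ?a = "axis a 1 :: real ^ 'k" and ?b = "axis b 1 :: real ^ 'k"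
    have "(\<integral>x. x $ a * x $ b \<partial>\<mu>) =
        (\<integral>x. ((?a + ?b) \<bullet> x)\<^sup>2 / 2 - (?a \<bullet> x)\<^sup>2 / 2 - (?b \<bullet> x)\<^sup>2 / 2 \<partial>\<mu>)"
      by (intro Bochner_Integration.integral_cong refl)
        (simp add: inner_add_left inner_axis' power2_eq_square algebra_simps)
    also have "\<dots> = Q (?a + ?b) (?a + ?b) / 2 - Q ?a ?a / 2 - Q ?b ?b / 2"
      using m(1)[of "?a + ?b"] m(1)[of ?a] m(1)[of ?b] by (simp add: m(4) Q(3))
    also have "\<dots> = Q ?a ?b"
      using Q(2)[of ?b ?a] by (simp add: linear_add[OF Q(1)] linear_add[OF lin] field_simps)
    finally show "(\<integral>x. x $ a * x $ b \<partial>\<mu>) = Q ?a ?b" .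
    show "(\<integral>x. x $ a \<partial>\<mu>) = 0" using m(3)[of ?a] by (simp add: inner_axis')
  qed
  show ?thesis unfolding covariance_matrix_def entry by simp
qed

text \<open>Two limits agree on bounded continuous functions, hence have the same characteristic function;
  by Levy's uniqueness theorem their one-dimensional projections agree, which determines the
  covariance matrix.\<close>

lemma asymptotic_variance_eqI:
  fixes Q :: "real ^ 'k \<Rightarrow> real ^ 'k \<Rightarrow> real" and Z :: "nat \<Rightarrow> 's \<Rightarrow> real ^ 'k"
  assumes \<mu>: "prob_space \<mu>" "sets \<mu> = sets borel"
      "\<And>t. (\<integral>x. iexp (t \<bullet> x) \<partial>\<mu>) = complex_of_real (exp (- Q t t / 2))"
    and Q: "\<And>s. linear (Q s)" "\<And>s t. Q s t = Q t s" "\<And>t. 0 \<le> Q t t"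
    and conv: "converges_in_distribution (\<lambda>n. distr M borel (Z n)) \<mu>"
  shows "asymptotic_variance M Z = (\<chi> a b. Q (axis a 1) (axis b 1))"
  unfolding asymptotic_variance_def
proof (rule the_equality)
  have "(\<lambda>s. Q s t) = Q t" for t by (intro ext Q)
  then have lin: "linear (\<lambda>s. Q s t)" for t using Q(1) by metis
  have scale: "Q (c *\<^sub>R t) (c *\<^sub>R t) = c\<^sup>2 * Q t t" for c t
    by (simp add: linear_scale[OF Q(1)] linear_scale[OF lin] power2_eq_square)
  note proj = projection_normal_law[where q = "\<lambda>t. Q t t", OF \<mu> Q(3) scale]
  have "multivariate_normal \<mu>"
    unfolding multivariate_normal_def using \<mu> proj Q(3) real_sqrt_ge_zero by blast
  moreover have "covariance_matrix \<mu> = (\<chi> a b. Q (axis a 1) (axis b 1))"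
    by (rule covariance_matrix_normal[where Q = Q]) (use \<mu> proj Q in auto)
  ultimately show "\<exists>\<mu>. multivariate_normal \<mu> \<and>
      converges_in_distribution (\<lambda>n. distr M borel (Z n)) \<mu> \<and>
      (\<chi> a b. Q (axis a 1) (axis b 1)) = covariance_matrix \<mu>"
    using conv by (intro exI[of _ \<mu>]) simp
  fix \<Sigma> :: "real ^ 'k ^ 'k"
  assume "\<exists>\<mu>. multivariate_normal \<mu> \<and>
      converges_in_distribution (\<lambda>n. distr M borel (Z n)) \<mu> \<and> \<Sigma> = covariance_matrix \<mu>"
  then obtain \<nu> where \<nu>: "multivariate_normal \<nu>" "converges_in_distribution (\<lambda>n. distr M borel (Z n)) \<nu>"
    "\<Sigma> = covariance_matrix \<nu>" by blast
  then have \<nu>': "prob_space \<nu>" "sets \<nu> = sets borel" by (auto simp: multivariate_normal_def)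
  have same: "(\<integral>x. g x \<partial>\<nu>) = (\<integral>x. g x \<partial>\<mu>)"
    if "continuous_on UNIV g" "bounded (range g)" for g :: "real ^ 'k \<Rightarrow> real"
    using that conv \<nu>(2) unfolding converges_in_distribution_def by (blast intro: LIMSEQ_unique)
  \<comment> \<open>Test functions in \<open>converges_in_distribution\<close> are real, so the
    complex exponential is split into cosine and sine, both bounded and continuous.\<close>
  have iexp: "(\<integral>x. iexp (t \<bullet> x) \<partial>\<nu>) = (\<integral>x. iexp (t \<bullet> x) \<partial>\<mu>)" for t
  proof -
    have "(\<integral>x. iexp (t \<bullet> x) \<partial>\<kappa>) = Complex (\<integral>x. cos (t \<bullet> x) \<partial>\<kappa>) (\<integral>x. sin (t \<bullet> x) \<partial>\<kappa>)"
      if "prob_space \<kappa>" "sets \<kappa> = sets borel" for \<kappa> :: "(real ^ 'k) measure"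
    proof -
      note i = integrable_iexp_inner[OF that, of t]
      have "Re (\<integral>x. iexp (t \<bullet> x) \<partial>\<kappa>) = (\<integral>x. cos (t \<bullet> x) \<partial>\<kappa>)"
        unfolding integral_Re[OF i, symmetric] by (simp add: Re_exp)
      moreover have "Im (\<integral>x. iexp (t \<bullet> x) \<partial>\<kappa>) = (\<integral>x. sin (t \<bullet> x) \<partial>\<kappa>)"
        unfolding integral_Im[OF i, symmetric] by (simp add: Im_exp)
      ultimately show ?thesis by (metis complex_surj)
    qed
    moreover have "(\<integral>x. cos (t \<bullet> x) \<partial>\<nu>) = (\<integral>x. cos (t \<bullet> x) \<partial>\<mu>)"
      by (rule same) (auto intro!: continuous_intros boundedI[of _ 1])
    moreover have "(\<integral>x. sin (t \<bullet> x) \<partial>\<nu>) = (\<integral>x. sin (t \<bullet> x) \<partial>\<mu>)"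
      by (rule same) (auto intro!: continuous_intros boundedI[of _ 1])
    ultimately show ?thesis using \<mu>(1,2) \<nu>' by simp
  qed
  show "\<Sigma> = (\<chi> a b. Q (axis a 1) (axis b 1))"
    unfolding \<nu>(3)
    by (rule covariance_matrix_normal[OF \<nu>'(2) projection_normal_law[where q = "\<lambda>t. Q t t", OF \<nu>' _ Q(3) scale] Q])
      (simp add: iexp \<mu>(3))
qed

section \<open>The multivariate central limit theorem\<close>

lemma (in finite_measure) integrable_norm_square:
  fixes g :: "'a \<Rightarrow> 'b::euclidean_space"
  assumes [measurable]: "g \<in> borel_measurable M" and "integrable M (\<lambda>x. (norm (g x))\<^sup>2)"
  shows "integrable M g"
  using square_integrable_imp_integrable[of "\<lambda>x. norm (g x)"] assms by (simp add: integrable_norm_iff)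

lemma (in prob_space) second_moment_sum:
  fixes X :: "nat \<Rightarrow> 'a \<Rightarrow> real"
  assumes indep: "indep_vars (\<lambda>_. borel) X UNIV"
    and int: "\<And>i. integrable M (X i)" "\<And>i. integrable M (\<lambda>\<omega>. (X i \<omega>)\<^sup>2)"
    and mean: "\<And>i. expectation (X i) = 0" and var: "\<And>i. expectation (\<lambda>\<omega>. (X i \<omega>)\<^sup>2) = v"
  shows "integrable M (\<lambda>\<omega>. (\<Sum>i<n. X i \<omega>)\<^sup>2)" "expectation (\<lambda>\<omega>. (\<Sum>i<n. X i \<omega>)\<^sup>2) = real n * v"
proof -
  have pair: "integrable M (\<lambda>\<omega>. X i \<omega> * X j \<omega>) \<and>
      expectation (\<lambda>\<omega>. X i \<omega> * X j \<omega>) = (if i = j then v else 0)" for i j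
  proof (cases "i = j")
    case True
    then show ?thesis using int(2)[of i] var[of i] by (simp add: power2_eq_square)
  next
    case False
    have "indep_vars (\<lambda>_. borel) X {i, j}" by (rule indep_vars_subset[OF indep]) simp
    from indep_vars_lebesgue_integral[OF _ this] indep_vars_integrable[OF _ this]
    show ?thesis using False int mean by simp
  qed
  have sq: "(\<Sum>i<n. X i \<omega>)\<^sup>2 = (\<Sum>i<n. \<Sum>j<n. X i \<omega> * X j \<omega>)" for \<omega>
    by (simp add: power2_eq_square sum_product)
  show "integrable M (\<lambda>\<omega>. (\<Sum>i<n. X i \<omega>)\<^sup>2)"
    unfolding sq using pair by (intro Bochner_Integration.integrable_sum) blast
  have "expectation (\<lambda>\<omega>. (\<Sum>i<n. X i \<omega>)\<^sup>2) = (\<Sum>i<n. \<Sum>j<n. expectation (\<lambda>\<omega>. X i \<omega> * X j \<omega>))"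
    unfolding sq using pair by (simp add: Bochner_Integration.integral_sum)
  also have "\<dots> = real n * v" using pair by simp
  finally show "expectation (\<lambda>\<omega>. (\<Sum>i<n. X i \<omega>)\<^sup>2) = real n * v" .
qed

text \<open>Cramer--Wold: a characteristic function on the whole space only looks at one projection
  at a time, and each projection is a normalised sum of real i.i.d. variables.\<close>

lemma (in prob_space) converges_in_distribution_normalized_sum:
  fixes V :: "nat \<Rightarrow> 'a \<Rightarrow> 'b::euclidean_space" and Q :: "'b \<Rightarrow> 'b \<Rightarrow> real"
  assumes indep: "indep_vars (\<lambda>_. borel) V UNIV"
    and ident: "\<And>i. distr M borel (V i) = distr M borel (V 0)"
    and sq: "integrable M (\<lambda>\<omega>. (norm (V 0 \<omega>))\<^sup>2)"
    and mean: "expectation (V 0) = 0"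
    and Q: "\<And>s t. Q s t = expectation (\<lambda>\<omega>. (s \<bullet> V 0 \<omega>) * (t \<bullet> V 0 \<omega>))"
    and \<mu>: "prob_space \<mu>" "sets \<mu> = sets borel"
      "\<And>t. (\<integral>x. iexp (t \<bullet> x) \<partial>\<mu>) = complex_of_real (exp (- Q t t / 2))"
    and Z: "\<And>n \<omega>. \<omega> \<in> space M \<Longrightarrow> Z n \<omega> = (1 / sqrt (real n)) *\<^sub>R (\<Sum>i<n. V i \<omega>)"
  shows "converges_in_distribution (\<lambda>n. distr M borel (Z n)) \<mu>"
proof -
  have V[measurable]: "V i \<in> borel_measurable M" for i
    using indep by (simp add: indep_vars_def2)
  have Zm[measurable]: "Z n \<in> borel_measurable M" for n
    by (subst measurable_cong[OF Z]) auto
  have int0: "integrable M (V 0)"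
    by (rule integrable_norm_square) (use sq in auto)
  have tm: "(\<lambda>x. t \<bullet> x) \<in> borel_measurable borel" for t :: 'b by simp
  have transfer: "expectation (\<lambda>\<omega>. g (V i \<omega>)) = expectation (\<lambda>\<omega>. g (V 0 \<omega>))"
    "integrable M (\<lambda>\<omega>. g (V i \<omega>)) \<longleftrightarrow> integrable M (\<lambda>\<omega>. g (V 0 \<omega>))"
    if "g \<in> borel_measurable borel" for g :: "'b \<Rightarrow> real" and i
    using integral_distr[OF V[of i] that] integral_distr[OF V[of 0] that]
      integrable_distr_eq[OF V[of i] that] integrable_distr_eq[OF V[of 0] that] ident[of i] by simp_all
  have int: "integrable M (\<lambda>\<omega>. t \<bullet> V i \<omega>)" for t i
    by (subst transfer(2)[OF tm]) (rule integrable_inner_right, rule int0)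
  have mean': "expectation (\<lambda>\<omega>. t \<bullet> V i \<omega>) = 0" for t i
    by (subst transfer(1)[OF tm]) (simp add: int0 mean)
  have int2: "integrable M (\<lambda>\<omega>. (t \<bullet> V i \<omega>)\<^sup>2)" for t i
  proof -
    have "integrable M (\<lambda>\<omega>. (t \<bullet> V 0 \<omega>)\<^sup>2)"
    proof (rule Bochner_Integration.integrable_bound)
      show "integrable M (\<lambda>\<omega>. (norm t)\<^sup>2 * (norm (V 0 \<omega>))\<^sup>2)" using sq by simp
      have "(t \<bullet> V 0 \<omega>)\<^sup>2 \<le> (norm t)\<^sup>2 * (norm (V 0 \<omega>))\<^sup>2" for \<omega>
        using power_mono[OF Cauchy_Schwarz_ineq2[of t "V 0 \<omega>"], of 2] by (simp add: power_mult_distrib)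
      then show "AE \<omega> in M. norm ((t \<bullet> V 0 \<omega>)\<^sup>2) \<le> norm ((norm t)\<^sup>2 * (norm (V 0 \<omega>))\<^sup>2)" by auto
    qed simp
    then show ?thesis by (subst transfer(2)[of "\<lambda>x. (t \<bullet> x)\<^sup>2"]) auto
  qed
  have var: "expectation (\<lambda>\<omega>. (t \<bullet> V i \<omega>)\<^sup>2) = Q t t" for t i
    by (subst transfer(1)[of "\<lambda>x. (t \<bullet> x)\<^sup>2"]) (simp_all add: Q power2_eq_square)
  have indep_t: "indep_vars (\<lambda>_. borel) (\<lambda>i \<omega>. t \<bullet> V i \<omega>) UNIV" for t
    by (rule indep_vars_compose2[OF indep]) simp
  have Qnn: "0 \<le> Q t t" for t by (subst var[of t 0, symmetric]) simp
  have lin_Q: "Q (c *\<^sub>R t) (c *\<^sub>R t) = c\<^sup>2 * Q t t" for c t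
    unfolding var[symmetric, of _ 0] by (simp add: power_mult_distrib)
  note moments = second_moment_sum[OF indep_t int int2 mean' var]
  have proj: "t \<bullet> Z n \<omega> = (\<Sum>i<n. t \<bullet> V i \<omega>) / sqrt (real n)" if "\<omega> \<in> space M" for t n \<omega>
    using Z[OF that] by (simp add: inner_sum_right)
  \<comment> \<open>The inequality is enough for the uniform moment bound and covers
    \<open>n = 0\<close>, where \<open>Z 0\<close> is zero because
    \<open>1 / sqrt 0 = 0\<close>.\<close>
  have proj_sq: "integrable M (\<lambda>\<omega>. (t \<bullet> Z n \<omega>)\<^sup>2) \<and> expectation (\<lambda>\<omega>. (t \<bullet> Z n \<omega>)\<^sup>2) \<le> Q t t" for t n
  proof -
    have eq: "(t \<bullet> Z n \<omega>)\<^sup>2 = (\<Sum>i<n. t \<bullet> V i \<omega>)\<^sup>2 / real n" if "\<omega> \<in> space M" for \<omega>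
      using proj[OF that] by (simp add: power_divide)
    have "integrable M (\<lambda>\<omega>. (\<Sum>i<n. t \<bullet> V i \<omega>)\<^sup>2 / real n)"
      by (intro integrable_divide moments)
    moreover have "expectation (\<lambda>\<omega>. (\<Sum>i<n. t \<bullet> V i \<omega>)\<^sup>2 / real n) = real n * Q t t / real n"
      by (simp only: integral_divide_zero moments)
    moreover have "real n * Q t t / real n \<le> Q t t" using Qnn[of t] by simp
    moreover have "expectation (\<lambda>\<omega>. (t \<bullet> Z n \<omega>)\<^sup>2) = expectation (\<lambda>\<omega>. (\<Sum>i<n. t \<bullet> V i \<omega>)\<^sup>2 / real n)"
      by (intro Bochner_Integration.integral_cong refl eq)
    moreover have "integrable M (\<lambda>\<omega>. (t \<bullet> Z n \<omega>)\<^sup>2) \<longleftrightarrow> integrable M (\<lambda>\<omega>. (\<Sum>i<n. t \<bullet> V i \<omega>)\<^sup>2 / real n)"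
      by (intro Bochner_Integration.integrable_cong refl eq)
    ultimately show ?thesis by linarith
  qed
  have norm_sq: "(norm x)\<^sup>2 = (\<Sum>b\<in>Basis. (b \<bullet> x)\<^sup>2)" for x :: 'b
    unfolding power2_norm_eq_inner by (subst euclidean_inner) (simp add: power2_eq_square inner_commute)
  show ?thesis
  proof (rule converges_in_distribution_characteristic_function[where C = "\<Sum>b\<in>Basis. Q b b"])
    show "prob_space (distr M borel (Z n))" for n by (rule prob_space_distr) simp
    show "sets (distr M borel (Z n)) = sets borel" for n by simp
    show "integrable (distr M borel (Z n)) (\<lambda>x. (norm x)\<^sup>2)" for n
      unfolding norm_sq using proj_sq
      by (subst integrable_distr_eq) (auto intro!: Bochner_Integration.integrable_sum)
    show "(\<integral>x. (norm x)\<^sup>2 \<partial>distr M borel (Z n)) \<le> (\<Sum>b\<in>Basis. Q b b)" for n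
    proof -
      have "(\<integral>x. (norm x)\<^sup>2 \<partial>distr M borel (Z n)) = expectation (\<lambda>\<omega>. \<Sum>b\<in>Basis. (b \<bullet> Z n \<omega>)\<^sup>2)"
        unfolding norm_sq by (rule integral_distr) simp_all
      also have "\<dots> = (\<Sum>b\<in>Basis. expectation (\<lambda>\<omega>. (b \<bullet> Z n \<omega>)\<^sup>2))"
        using proj_sq by (intro Bochner_Integration.integral_sum) auto
      also have "\<dots> \<le> (\<Sum>b\<in>Basis. Q b b)"
        using proj_sq by (intro sum_mono) auto
      finally show ?thesis .
    qed
    show "integrable \<mu> (\<lambda>x. (norm x)\<^sup>2)"
      unfolding norm_sq
      using projection_moments(1)[OF \<mu>(2) projection_normal_law[where q = "\<lambda>t. Q t t", OF \<mu> Qnn lin_Q]] Qnn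
      by (intro Bochner_Integration.integrable_sum) auto
  next
    fix t :: 'b
    have iexp_m: "(\<lambda>x. iexp (t \<bullet> x)) \<in> borel_measurable borel"
      by (intro borel_measurable_continuous_onI continuous_intros)
    have lhs: "(\<integral>x. iexp (t \<bullet> x) \<partial>distr M borel (Z n)) = expectation (\<lambda>\<omega>. iexp (t \<bullet> Z n \<omega>))" for n
      by (rule integral_distr[OF Zm iexp_m])
    show "(\<lambda>n. \<integral>x. iexp (t \<bullet> x) \<partial>distr M borel (Z n)) \<longlonglongrightarrow> (\<integral>x. iexp (t \<bullet> x) \<partial>\<mu>)"
    proof (cases "Q t t = 0")
      \<comment> \<open>The one-dimensional theorem needs positive variance. In a direction of zero
        variance the projection is almost surely zero for every \<open>n\<close>.\<close>
      case True
      have "expectation (\<lambda>\<omega>. iexp (t \<bullet> Z n \<omega>)) = 1" for n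
      proof -
        have "expectation (\<lambda>\<omega>. (t \<bullet> Z n \<omega>)\<^sup>2) = 0"
          using proj_sq[of t n] True by (intro antisym) (auto intro: integral_nonneg)
        then have "AE \<omega> in M. t \<bullet> Z n \<omega> = 0"
          using proj_sq[of t n] by (subst (asm) integral_nonneg_eq_0_iff_AE) auto
        then have "expectation (\<lambda>\<omega>. iexp (t \<bullet> Z n \<omega>)) = expectation (\<lambda>\<omega>. 1)"
          using measurable_compose[OF Zm iexp_m] by (intro integral_cong_AE) auto
        then show ?thesis by (simp add: prob_space)
      qed
      then show ?thesis unfolding lhs \<mu>(3) True by simp
    next
      case False
      define \<sigma> where "\<sigma> = sqrt (Q t t)"
      have \<sigma>: "\<sigma> > 0" "\<sigma>\<^sup>2 = Q t t" using Qnn[of t] False by (auto simp: \<sigma>_def)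
      \<comment> \<open>Here the sums are scaled to variance one; evaluating characteristic
        functions at \<open>\<sigma>\<close> undoes the division by \<open>\<sigma>\<close>.\<close>
      let ?S = "\<lambda>n \<omega>. (\<Sum>i<n. t \<bullet> V i \<omega>) / sqrt (real n * \<sigma>\<^sup>2)"
      have Sm: "?S n \<in> borel_measurable M" for n by measurable
      have "weak_conv_m (\<lambda>n. distr M borel (?S n)) std_normal_distribution"
      proof (rule central_limit_theorem_zero_mean[where \<mu> = "distr (distr M borel (V 0)) borel (\<lambda>x. t \<bullet> x)"])
        show "distr M borel (\<lambda>\<omega>. t \<bullet> V i \<omega>) = distr (distr M borel (V 0)) borel (\<lambda>x. t \<bullet> x)" for i
          unfolding ident[of i, symmetric] by (subst distr_distr) (auto simp: comp_def)
        show "variance (\<lambda>\<omega>. t \<bullet> V i \<omega>) = \<sigma>\<^sup>2" for i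
          by (simp only: mean' \<sigma>(2) var diff_zero)
      qed (use indep_t mean' int2 \<sigma> in auto)
      from levy_continuity1[OF real_distribution_distr[OF Sm] real_dist_normal_dist this, of \<sigma>]
      have "(\<lambda>n. char (distr M borel (?S n)) \<sigma>) \<longlonglongrightarrow> char std_normal_distribution \<sigma>" .
      moreover have "char (distr M borel (?S n)) \<sigma> = expectation (\<lambda>\<omega>. iexp (t \<bullet> Z n \<omega>))" for n
      proof -
        have "char (distr M borel (?S n)) \<sigma> = expectation (\<lambda>\<omega>. iexp (\<sigma> * ?S n \<omega>))"
          unfolding char_def by (rule integral_distr[OF Sm]) measurable
        also have "\<dots> = expectation (\<lambda>\<omega>. iexp (t \<bullet> Z n \<omega>))"
        proof (rule Bochner_Integration.integral_cong[OF refl])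
          fix \<omega> assume "\<omega> \<in> space M"
          then have "\<sigma> * ?S n \<omega> = t \<bullet> Z n \<omega>"
            using \<sigma>(1) by (simp add: proj real_sqrt_mult)
          then show "iexp (\<sigma> * ?S n \<omega>) = iexp (t \<bullet> Z n \<omega>)" by (simp only:)
        qed
        finally show ?thesis .
      qed
      moreover have "char std_normal_distribution \<sigma> = (\<integral>x. iexp (t \<bullet> x) \<partial>\<mu>)"
        unfolding \<mu>(3) \<sigma>(2)[symmetric] char_std_normal_distribution ..
      ultimately show ?thesis unfolding lhs by simp
    qed
  qed (use \<mu> in auto)
qed

text \<open>After centring, the covariance form of a single summand is symmetric and nonnegative,
  hence realised by some normal law, which is then the limit. Degenerate summands are
  included.\<close>

theorem (in prob_space) asymptotic_variance_normalized_mean: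
  fixes Y :: "nat \<Rightarrow> 'a \<Rightarrow> real ^ 'k"
  assumes indep: "indep_vars (\<lambda>_. borel) Y UNIV"
    and ident: "\<And>i. distr M borel (Y i) = distr M borel (Y 0)"
    and sq: "integrable M (\<lambda>\<omega>. (norm (Y 0 \<omega>))\<^sup>2)"
    and mean: "expectation (Y 0) = m"
    and Z: "\<And>n \<omega>. \<omega> \<in> space M \<Longrightarrow> Z n \<omega> = sqrt (real n) *\<^sub>R ((1 / real n) *\<^sub>R (\<Sum>i<n. Y i \<omega>) - m)"
  shows "asymptotic_variance M Z = (\<chi> a b. expectation (\<lambda>\<omega>. Y 0 \<omega> $ a * Y 0 \<omega> $ b) - m $ a * m $ b)"
proof -
  have Ym[measurable]: "Y i \<in> borel_measurable M" for i
    using indep by (simp add: indep_vars_def2)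
  have int0: "integrable M (Y 0)"
    by (rule integrable_norm_square) (use sq in auto)
  define V where "V i \<omega> = Y i \<omega> - m" for i \<omega>
  have Vm[measurable]: "V i \<in> borel_measurable M" for i unfolding V_def by measurable
  have Vsq: "integrable M (\<lambda>\<omega>. (norm (V 0 \<omega>))\<^sup>2)"
  proof (rule Bochner_Integration.integrable_bound)
    show "integrable M (\<lambda>\<omega>. 2 * (norm (Y 0 \<omega>))\<^sup>2 + 2 * (norm m)\<^sup>2)" using sq by simp
    have "(norm (V 0 \<omega>))\<^sup>2 \<le> 2 * (norm (Y 0 \<omega>))\<^sup>2 + 2 * (norm m)\<^sup>2" for \<omega>
    proof -
      have "(norm (V 0 \<omega>))\<^sup>2 \<le> (norm (Y 0 \<omega>) + norm m)\<^sup>2"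
        unfolding V_def by (intro power_mono norm_triangle_ineq4) simp
      also have "\<dots> \<le> 2 * (norm (Y 0 \<omega>))\<^sup>2 + 2 * (norm m)\<^sup>2"
        using zero_le_power2[of "norm (Y 0 \<omega>) - norm m"] by (simp add: power2_diff power2_sum)
      finally show ?thesis .
    qed
    then show "AE \<omega> in M. norm ((norm (V 0 \<omega>))\<^sup>2) \<le> norm (2 * (norm (Y 0 \<omega>))\<^sup>2 + 2 * (norm m)\<^sup>2)" by auto
  qed simp
  have prod_int: "integrable M (\<lambda>\<omega>. (s \<bullet> U \<omega>) * (t \<bullet> U \<omega>))"
    if [measurable]: "U \<in> borel_measurable M" and sq: "integrable M (\<lambda>\<omega>. (norm (U \<omega>))\<^sup>2)"
    for s t :: "real ^ 'k" and U
  proof (rule Bochner_Integration.integrable_bound)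
    show "integrable M (\<lambda>\<omega>. norm s * norm t * (norm (U \<omega>))\<^sup>2)" using sq by simp
    have "\<bar>(s \<bullet> U \<omega>) * (t \<bullet> U \<omega>)\<bar> \<le> norm s * norm t * (norm (U \<omega>))\<^sup>2" for \<omega>
      using mult_mono[OF Cauchy_Schwarz_ineq2[of s "U \<omega>"] Cauchy_Schwarz_ineq2[of t "U \<omega>"]]
      by (simp add: abs_mult power2_eq_square mult_ac)
    then show "AE \<omega> in M. norm ((s \<bullet> U \<omega>) * (t \<bullet> U \<omega>)) \<le> norm (norm s * norm t * (norm (U \<omega>))\<^sup>2)"
      by (auto simp: abs_mult)
  qed simp
  define Q where "Q s t = expectation (\<lambda>\<omega>. (s \<bullet> V 0 \<omega>) * (t \<bullet> V 0 \<omega>))" for s t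
  have lin: "linear (Q s)" for s
    unfolding Q_def
    by (intro linearI)
      (simp_all add: inner_add_left distrib_left prod_int[OF Vm Vsq] mult.left_commute)
  have sym: "Q s t = Q t s" for s t unfolding Q_def by (simp only: mult.commute)
  have psd: "0 \<le> Q t t" for t unfolding Q_def by simp
  obtain \<mu> where \<mu>: "prob_space \<mu>" "sets \<mu> = sets borel"
      "\<And>t. (\<integral>x. iexp (t \<bullet> x) \<partial>\<mu>) = complex_of_real (exp (- Q t t / 2))"
    using gaussian_characteristic_function_exists[of Basis Q] lin sym psd by auto
  have "asymptotic_variance M Z = (\<chi> a b. Q (axis a 1) (axis b 1))"
  proof (rule asymptotic_variance_eqI[OF \<mu> lin sym psd])
    show "converges_in_distribution (\<lambda>n. distr M borel (Z n)) \<mu>"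
    proof (rule converges_in_distribution_normalized_sum[where V = V and Q = Q, OF _ _ Vsq _ Q_def \<mu>])
      show "indep_vars (\<lambda>_. borel) V UNIV"
        unfolding V_def by (rule indep_vars_compose2[OF indep]) simp
      have "distr M borel (V i) = distr (distr M borel (Y i)) borel (\<lambda>y. y - m)" for i
        by (subst distr_distr) (auto simp: comp_def V_def[abs_def])
      then show "distr M borel (V i) = distr M borel (V 0)" for i by (simp only: ident[of i])
      show "expectation (V 0) = 0" unfolding V_def using int0 mean by (simp add: prob_space)
      show "Z n \<omega> = (1 / sqrt (real n)) *\<^sub>R (\<Sum>i<n. V i \<omega>)" if "\<omega> \<in> space M" for n \<omega>
      \<comment> \<open>For \<open>n = 0\<close> both sides are the zero vector.\<close>
      proof (cases "n = 0")
        case False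
        have c: "1 / sqrt (real n) = sqrt (real n) * (1 / real n)" "real n / sqrt (real n) = sqrt (real n)"
          using False by (simp_all add: field_simps real_div_sqrt)
        have "(1 / sqrt (real n)) *\<^sub>R (\<Sum>i<n. V i \<omega>) =
            (1 / sqrt (real n)) *\<^sub>R (\<Sum>i<n. Y i \<omega>) - (real n / sqrt (real n)) *\<^sub>R m"
          by (simp add: V_def sum_subtractf scaleR_diff_right sum_constant_scaleR del: sum_constant)
        then show ?thesis
          unfolding Z[OF that] c by (simp only: scaleR_diff_right scaleR_scaleR)
      qed (use Z[OF that] in simp)
    qed
  qed
  moreover have "Q (axis a 1) (axis b 1) = expectation (\<lambda>\<omega>. Y 0 \<omega> $ a * Y 0 \<omega> $ b) - m $ a * m $ b" for a b
  proof -
    have i: "integrable M (\<lambda>\<omega>. Y 0 \<omega> $ a * Y 0 \<omega> $ b)"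
      using prod_int[OF Ym sq, of "axis a 1" "axis b 1"] by (simp add: inner_axis')
    have e: "integrable M (\<lambda>\<omega>. Y 0 \<omega> $ c)" "expectation (\<lambda>\<omega>. Y 0 \<omega> $ c) = m $ c" for c
      using integrable_inner_right[OF int0, of "axis c 1"] integral_inner_right[OF int0, of "axis c 1"] mean
      by (simp_all add: inner_axis')
    have "Q (axis a 1) (axis b 1) = expectation (\<lambda>\<omega>. Y 0 \<omega> $ a * Y 0 \<omega> $ b
        - m $ b * Y 0 \<omega> $ a - m $ a * Y 0 \<omega> $ b + m $ a * m $ b)"
      unfolding Q_def
      by (intro Bochner_Integration.integral_cong refl) (simp add: V_def inner_axis' algebra_simps)
    also have "\<dots> = expectation (\<lambda>\<omega>. Y 0 \<omega> $ a * Y 0 \<omega> $ b) - m $ a * m $ b"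
      using i e[of a] e[of b] by (simp add: prob_space)
    finally show ?thesis .
  qed
  ultimately show ?thesis by simp
qed

section \<open>Weighted sums of squares on the simplex\<close>

text \<open>Minimiser of the sum of \<open>od (p j) * (d j)\<^sup>2\<close> over \<open>d\<close>
  with sum one: inverse-odds weights if all odds are positive. Sources with \<open>p k = 1\<close>
  have zero odds and cost nothing, so they take all the weight; the equal split among them is one
  choice out of many.\<close>

definition optimal_weight :: "(nat \<Rightarrow> real) \<Rightarrow> nat set \<Rightarrow> nat \<Rightarrow> real"
  where "optimal_weight p S j =
    (if \<exists>k\<in>S. p k = 1 then of_bool (p j = 1) / real (card {k \<in> S. p k = 1})
     else 1 / od (p j) / (\<Sum>k\<in>S. 1 / od (p k)))"

lemma od_nonneg: "0 < q \<Longrightarrow> q \<le> 1 \<Longrightarrow> 0 \<le> od q"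
  by (simp add: od_def)

lemma od_pos: "0 < q \<Longrightarrow> q < 1 \<Longrightarrow> 0 < od q"
  by (simp add: od_def)

lemma od_one: "od 1 = 0"
  by (simp add: od_def)

context
  fixes p :: "nat \<Rightarrow> real" and S :: "nat set"
  assumes S: "finite S" "S \<noteq> {}" and p: "\<forall>j\<in>S. 0 < p j \<and> p j \<le> 1"
begin

lemma optimal_weight_nonneg:
  assumes "j \<in> S" shows "0 \<le> optimal_weight p S j"
proof -
  have od: "0 \<le> od (p k)" if "k \<in> S" for k using p that by (intro od_nonneg) auto
  then have "0 \<le> (\<Sum>k\<in>S. 1 / od (p k))" by (intro sum_nonneg) simp
  then show ?thesis using od[OF assms] by (simp add: optimal_weight_def)
qed

lemma optimal_weight_sum: "(\<Sum>j\<in>S. optimal_weight p S j) = 1"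
proof (cases "\<exists>k\<in>S. p k = 1")
  case True
  then have "card {k \<in> S. p k = 1} > 0" using S by (auto simp: card_gt_0_iff)
  moreover have "(\<Sum>j\<in>S. of_bool (p j = 1)) = real (card {k \<in> S. p k = 1})"
    using S by (simp add: Int_def)
  ultimately show ?thesis
    using True unfolding optimal_weight_def by (simp add: sum_divide_distrib[symmetric])
next
  case False
  then have "(\<Sum>k\<in>S. 1 / od (p k)) > 0"
    using S p od_pos by (intro sum_pos) (auto simp: less_le)
  then show ?thesis
    using False unfolding optimal_weight_def
    by (simp only: if_False sum_divide_distrib[symmetric]) simp
qed

lemma optimal_weight_le_1:
  assumes "j \<in> S" shows "optimal_weight p S j \<le> 1"
  using member_le_sum[OF assms _ S(1), of "optimal_weight p S"] optimal_weight_nonneg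
  unfolding optimal_weight_sum by simp

text \<open>The stationarity condition of the Lagrange multiplier rule.\<close>

lemma optimal_weight_stationary: "\<exists>l. \<forall>j\<in>S. od (p j) * optimal_weight p S j = l"
proof (cases "\<exists>k\<in>S. p k = 1")
  case True
  then show ?thesis by (intro exI[of _ 0]) (auto simp: optimal_weight_def od_one)
next
  case False
  have "od (p j) * optimal_weight p S j = 1 / (\<Sum>k\<in>S. 1 / od (p k))" if "j \<in> S" for j
  proof -
    have "p j < 1" using p False that by (auto simp: less_le)
    then have "od (p j) > 0" using p that by (intro od_pos) auto
    then show ?thesis using False by (simp add: optimal_weight_def)
  qed
  then show ?thesis by blast
qed

text \<open>Expanding the square around the optimal weights leaves a cross term with the constant
  coefficient \<open>2 * l\<close>. It cancels because both families sum to one. The identity also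
  covers zero odds.\<close>

lemma weighted_square_excess:
  assumes "(\<Sum>j\<in>S. d j) = 1"
  shows "(\<Sum>j\<in>S. od (p j) * (d j)\<^sup>2) =
    (\<Sum>j\<in>S. od (p j) * (optimal_weight p S j)\<^sup>2) + (\<Sum>j\<in>S. od (p j) * (d j - optimal_weight p S j)\<^sup>2)"
proof -
  let ?o = "optimal_weight p S"
  obtain l where l: "\<And>j. j \<in> S \<Longrightarrow> od (p j) * ?o j = l" using optimal_weight_stationary by blast
  have "(\<Sum>j\<in>S. od (p j) * (d j)\<^sup>2) =
      (\<Sum>j\<in>S. od (p j) * (?o j)\<^sup>2 + od (p j) * (d j - ?o j)\<^sup>2 + 2 * l * (d j - ?o j))"
    by (intro sum.cong refl) (simp add: l[symmetric] power2_eq_square algebra_simps)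
  also have "\<dots> = (\<Sum>j\<in>S. od (p j) * (?o j)\<^sup>2) + (\<Sum>j\<in>S. od (p j) * (d j - ?o j)\<^sup>2)
      + 2 * l * ((\<Sum>j\<in>S. d j) - (\<Sum>j\<in>S. ?o j))"
    by (simp only: sum.distrib sum_distrib_left[symmetric] sum_subtractf)
  finally show ?thesis using assms optimal_weight_sum by simp
qed

end

text \<open>The quotient of products is the inverse-odds weight with numerator and denominator
  multiplied by \<open>od (p j)\<close> and by the product \<open>P\<close> over
  \<open>K\<close>.\<close>

lemma optimal_weight_formula:
  assumes K: "finite K" "j \<notin> K" "p j < 1" and p: "\<forall>k\<in>insert j K. 0 < p k \<and> p k \<le> 1"
  shows "\<exists>k\<in>K. p k = 1 \<Longrightarrow> optimal_weight p (insert j K) j = 0"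
    and "\<forall>k\<in>K. p k < 1 \<Longrightarrow> optimal_weight p (insert j K) j = (\<Prod>k\<in>K. od (p k)) /
      ((\<Prod>k\<in>K. od (p k)) + od (p j) * (\<Sum>n\<in>K. (\<Prod>k\<in>K. od (p k)) / od (p n)))"
proof -
  show "optimal_weight p (insert j K) j = 0" if "\<exists>k\<in>K. p k = 1"
    using that \<open>p j < 1\<close> by (simp add: optimal_weight_def)
  assume lt: "\<forall>k\<in>K. p k < 1"
  then have none: "\<not> (\<exists>k\<in>insert j K. p k = 1)" using \<open>p j < 1\<close> by auto
  have pos: "od (p k) > 0" if "k \<in> insert j K" for k
    using p lt \<open>p j < 1\<close> that by (intro od_pos) auto
  define P where "P = (\<Prod>k\<in>K. od (p k))"
  define s where "s = (\<Sum>n\<in>K. 1 / od (p n))"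
  have P: "P > 0" unfolding P_def using pos by (intro prod_pos) auto
  have s: "s \<ge> 0" unfolding s_def using pos by (intro sum_nonneg) (auto simp: less_imp_le)
  have j: "od (p j) > 0" using pos by simp
  have "optimal_weight p (insert j K) j = 1 / od (p j) / (1 / od (p j) + s)"
    unfolding optimal_weight_def s_def using none K by simp
  also have "\<dots> = 1 / (1 + od (p j) * s)"
    using j by (simp add: field_simps)
  also have "\<dots> = P / (P * (1 + od (p j) * s))"
    using P by simp
  also have "P * (1 + od (p j) * s) = P + od (p j) * (P * s)"
    by (simp add: algebra_simps)
  also have "P * s = (\<Sum>n\<in>K. P / od (p n))"
    unfolding s_def by (simp add: sum_distrib_left)
  finally show "optimal_weight p (insert j K) j = (\<Prod>k\<in>K. od (p k)) /
      ((\<Prod>k\<in>K. od (p k)) + od (p j) * (\<Sum>n\<in>K. (\<Prod>k\<in>K. od (p k)) / od (p n)))"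
    unfolding P_def .
qed

text \<open>For \<open>p j < 1\<close> exactly one of the two clauses applies, since every
  \<open>p k\<close> is at most one. For \<open>p j = 1\<close> both sides are vacuous, which is the
  arbitrary case.\<close>

lemma optimal_weight_iff:
  assumes K: "finite K" "j \<notin> K" and p: "\<forall>k\<in>insert j K. 0 < p k \<and> p k \<le> 1"
  shows "(p j < 1 \<and> (\<exists>k\<in>K. p k = 1) \<longrightarrow> c = 0) \<and>
      (p j < 1 \<and> (\<forall>k\<in>K. p k < 1) \<longrightarrow> c = (\<Prod>k\<in>K. od (p k)) /
        ((\<Prod>k\<in>K. od (p k)) + od (p j) * (\<Sum>n\<in>K. (\<Prod>k\<in>K. od (p k)) / od (p n)))) \<longleftrightarrow>
    (p j < 1 \<longrightarrow> c = optimal_weight p (insert j K) j)"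
proof (cases "p j < 1")
  case True
  note formula = optimal_weight_formula[OF K True p]
  show ?thesis
  proof (cases "\<exists>k\<in>K. p k = 1")
    case one: True
    then show ?thesis using True formula(1)[OF one] by auto
  next
    case False
    then have all: "\<forall>k\<in>K. p k < 1" using p by (auto simp: less_le)
    then show ?thesis using True False formula(2)[OF all] by simp
  qed
qed simp

text \<open>The quotient also holds for a fully sampled source: positivity of the sum prevents both
  from being fully sampled, so this source alone gets weight one.\<close>

lemma optimal_weight_pair:
  assumes p: "0 < p 1" "p 1 \<le> 1" "0 < p 2" "p 2 \<le> 1" and pos: "od (p 1) + od (p 2) > 0"
  shows "optimal_weight p {1, 2} 1 = od (p 2) / (od (p 1) + od (p 2))"
    and "optimal_weight p {1, 2} 2 = od (p 1) / (od (p 1) + od (p 2))"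
proof -
  have *: "optimal_weight p {i, j} i = od (p j) / (od (p i) + od (p j))"
    if ij: "i \<noteq> j" and p: "0 < p i" "p i \<le> 1" "0 < p j" "p j \<le> 1" and pos: "od (p i) + od (p j) > 0"
    for i j
  proof (cases "p i < 1")
    case True
    show ?thesis
    proof (cases "p j = 1")
      case one: True
      then show ?thesis using optimal_weight_formula(1)[of "{j}" i p] ij p True by (simp add: od_one)
    next
      case False
      then show ?thesis
        using optimal_weight_formula(2)[of "{j}" i p] ij p True od_pos[of "p j"] by (simp add: add.commute)
    qed
  next
    case False
    then have "p i = 1" using p by simp
    then have "p j \<noteq> 1" using pos by (auto simp: od_one)
    with \<open>p i = 1\<close> have "{k \<in> {i, j}. p k = 1} = {i}" by auto
    then show ?thesis using \<open>p i = 1\<close> pos by (simp add: optimal_weight_def od_one)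
  qed
  show "optimal_weight p {1, 2} 1 = od (p 2) / (od (p 1) + od (p 2))" by (rule *) (use p pos in auto)
  have "{1, 2} = {2, 1::nat}" by auto
  then show "optimal_weight p {1, 2} 2 = od (p 1) / (od (p 1) + od (p 2))"
    using *[of 2 1] p pos by (simp add: add.commute)
qed

section \<open>Bernoulli sampling of units\<close>

context multisource_bernoulli_sampling
begin

definition src :: "'x \<times> 'u \<Rightarrow> nat set"
  where "src w = sources_of J Vs (obs coarse w)"

text \<open>Restricting the indicators to the source indices places them in the finite set
  \<open>patterns\<close>, so that expectations over selections become finite sums.\<close>

definition selection :: "nat \<Rightarrow> 's \<Rightarrow> nat \<Rightarrow> bool"
  where "selection i \<omega> = (\<lambda>j\<in>{1..J}. R i j \<omega>)"

abbreviation patterns :: "(nat \<Rightarrow> bool) set"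
  where "patterns \<equiv> PiE {1..J} (\<lambda>_. UNIV)"

definition pattern_prob :: "nat set \<Rightarrow> (nat \<Rightarrow> bool) \<Rightarrow> real"
  where "pattern_prob S r =
    (\<Prod>j\<in>{1..J}. pmf (if j \<in> S then bernoulli_pmf (p j) else return_pmf False) (r j))"

section \<open>Measurability and integrability for functions of the source set\<close>

lemma sets_Pt [measurable_cong]: "sets Pt = sets (XM \<Otimes>\<^sub>M UM)"
  using data_law[of 0] by auto

lemma space_Pt: "space Pt = space (XM \<Otimes>\<^sub>M UM)"
  by (rule sets_eq_imp_space_eq) (rule sets_Pt)

lemma W_measurable [measurable]: "W i \<in> measurable M (XM \<Otimes>\<^sub>M UM)"
  using data_indep by (simp add: indep_vars_def2)

lemma W_space: "\<omega> \<in> space M \<Longrightarrow> W i \<omega> \<in> space (XM \<Otimes>\<^sub>M UM)"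
  using W_measurable[of i] by (rule measurable_space)

lemma prob_space_Pt: "prob_space Pt"
  using prob_space_distr[OF W_measurable[of 0]] data_law[of 0] by simp

lemma finite_patterns [simp]: "finite patterns"
  by (intro finite_PiE) auto

lemma selection_in_patterns: "selection i \<omega> \<in> patterns"
  by (simp add: selection_def)

text \<open>Each fibre of \<open>src\<close> is a finite intersection of source events and
  complements of source events.\<close>

lemma src_measurable: "src \<in> measurable (XM \<Otimes>\<^sub>M UM) (count_space (Pow {1..J}))"
proof (subst measurable_count_space_eq2)
  have obs: "obs coarse \<in> measurable (XM \<Otimes>\<^sub>M UM) (CM \<Otimes>\<^sub>M UM)"
    unfolding obs_def[abs_def]
    by (rule measurable_Pair[OF measurable_compose[OF measurable_fst coarse] measurable_snd])
  have "src -` {S} \<inter> space (XM \<Otimes>\<^sub>M UM) \<in> sets (XM \<Otimes>\<^sub>M UM)" if "S \<in> Pow {1..J}" for S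
  proof -
    have "src -` {S} \<inter> space (XM \<Otimes>\<^sub>M UM) =
        {w \<in> space (XM \<Otimes>\<^sub>M UM). \<forall>j\<in>{1..J}. obs coarse w \<in> Vs j \<longleftrightarrow> j \<in> S}"
    proof -
      have "src w = S \<longleftrightarrow> (\<forall>j\<in>{1..J}. obs coarse w \<in> Vs j \<longleftrightarrow> j \<in> S)" for w
        using that unfolding src_def sources_of_def by blast
      then show ?thesis by blast
    qed
    also have "\<dots> \<in> sets (XM \<Otimes>\<^sub>M UM)"
    proof (rule sets.sets_Collect_finite_All)
      fix j assume "j \<in> {1..J}"
      then have "obs coarse -` Vs j \<inter> space (XM \<Otimes>\<^sub>M UM) \<in> sets (XM \<Otimes>\<^sub>M UM)"
        by (intro measurable_sets[OF obs] source_sets)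
      moreover have "obs coarse -` Vs j \<inter> space (XM \<Otimes>\<^sub>M UM) = {w \<in> space (XM \<Otimes>\<^sub>M UM). obs coarse w \<in> Vs j}"
        by auto
      ultimately have "{w \<in> space (XM \<Otimes>\<^sub>M UM). obs coarse w \<in> Vs j} \<in> sets (XM \<Otimes>\<^sub>M UM)" by simp
      then show "{w \<in> space (XM \<Otimes>\<^sub>M UM). (obs coarse w \<in> Vs j) = (j \<in> S)} \<in> sets (XM \<Otimes>\<^sub>M UM)"
        by (cases "j \<in> S") (auto intro: sets.sets_Collect_neg)
    qed simp
    finally show ?thesis .
  qed
  then show "src \<in> space (XM \<Otimes>\<^sub>M UM) \<rightarrow> Pow {1..J} \<and>
      (\<forall>a\<in>Pow {1..J}. src -` {a} \<inter> space (XM \<Otimes>\<^sub>M UM) \<in> sets (XM \<Otimes>\<^sub>M UM))"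
    by (auto simp: src_def sources_of_def)
qed simp

lemma src_function_measurable [measurable]:
  fixes D :: "nat set \<Rightarrow> real"
  shows "(\<lambda>w. D (src w)) \<in> borel_measurable (XM \<Otimes>\<^sub>M UM)"
  by (rule measurable_compose[OF src_measurable]) simp

text \<open>\<open>src\<close> has finitely many values, so an arbitrary function of it is bounded,
  here by the sum of the absolute values over all subsets.\<close>

lemma integrable_src_mult:
  fixes D :: "nat set \<Rightarrow> real" and g :: "'x \<times> 'u \<Rightarrow> real"
  assumes "integrable Pt g"
  shows "integrable Pt (\<lambda>w. D (src w) * g w)"
proof (rule Bochner_Integration.integrable_bound)
  let ?B = "\<Sum>S\<in>Pow {1..J}. \<bar>D S\<bar>"
  show "integrable Pt (\<lambda>w. ?B * g w)" using assms by simp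
  show "(\<lambda>w. D (src w) * g w) \<in> borel_measurable Pt"
    using borel_measurable_integrable[OF assms] by measurable
  have "\<bar>D (src w)\<bar> \<le> ?B" for w
    by (rule member_le_sum) (auto simp: src_def sources_of_def)
  then show "AE w in Pt. norm (D (src w) * g w) \<le> norm (?B * g w)"
    by (auto simp: abs_mult sum_nonneg intro!: mult_right_mono)
qed

lemma pattern_prob_src: "pattern_prob (src w) r =
    (\<Prod>j\<in>{1..J}. pmf (if obs coarse w \<in> Vs j then bernoulli_pmf (p j) else return_pmf False) (r j))"
  unfolding pattern_prob_def by (rule prod.cong) (simp_all add: src_def sources_of_def)

lemma sum_pattern_prob: "(\<Sum>r\<in>patterns. pattern_prob S r) = 1"
proof -
  have "(\<Sum>r\<in>patterns. pattern_prob S r) =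
      (\<Prod>j\<in>{1..J}. \<Sum>b\<in>UNIV. pmf (if j \<in> S then bernoulli_pmf (p j) else return_pmf False) b)"
    unfolding pattern_prob_def by (rule prod_sum_PiE[symmetric]) auto
  also have "\<dots> = 1"
    by (intro prod.neutral ballI sum_pmf_eq_1) auto
  finally show ?thesis .
qed

text \<open>The two indicators are absorbed into the product over sources, and the sum over patterns
  factorises. Sources other than \<open>j\<close> and \<open>k\<close> contribute one. If
  \<open>j = k\<close>, the set \<open>{j, k}\<close> is a singleton and the squared indicator
  counts once.\<close>

lemma sum_pattern_prob_pair:
  assumes S: "S \<subseteq> {1..J}" and j: "j \<in> {1..J}" and k: "k \<in> {1..J}"
  defines "\<pi> \<equiv> \<lambda>j. p j * of_bool (j \<in> S)"
  shows "(\<Sum>r\<in>patterns. of_bool (r j) * of_bool (r k) * pattern_prob S r) =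
    (if j = k then \<pi> j else \<pi> j * \<pi> k)"
proof -
  let ?m = "\<lambda>i. if i \<in> S then bernoulli_pmf (p i) else return_pmf False"
  have prod_jk: "(\<Prod>i\<in>{1..J}. if i \<in> {j, k} then F i else 1) = (\<Prod>i\<in>{j, k}. F i)"
    for F :: "nat \<Rightarrow> real"
    by (subst prod.inter_restrict[symmetric]) (use j k in \<open>auto intro!: prod.cong\<close>)
  have "(\<Sum>r\<in>patterns. of_bool (r j) * of_bool (r k) * pattern_prob S r) =
      (\<Sum>r\<in>patterns. \<Prod>i\<in>{1..J}. (if i \<in> {j, k} then of_bool (r i) else 1) * pmf (?m i) (r i))"
  proof (rule sum.cong[OF refl])
    fix r :: "nat \<Rightarrow> bool"
    show "of_bool (r j) * of_bool (r k) * pattern_prob S r =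
        (\<Prod>i\<in>{1..J}. (if i \<in> {j, k} then of_bool (r i) else 1) * pmf (?m i) (r i))"
      unfolding prod.distrib prod_jk pattern_prob_def by (cases "j = k") auto
  qed
  also have "\<dots> = (\<Prod>i\<in>{1..J}. \<Sum>b\<in>UNIV. (if i \<in> {j, k} then of_bool b else 1) * pmf (?m i) b)"
    by (rule prod_sum_PiE[symmetric]) auto
  also have "\<dots> = (\<Prod>i\<in>{1..J}. if i \<in> {j, k} then \<pi> i else 1)"
  proof (rule prod.cong[OF refl])
    fix i assume "i \<in> {1..J}"
    then show "(\<Sum>b\<in>UNIV. (if i \<in> {j, k} then of_bool b else 1) * pmf (?m i) b) =
        (if i \<in> {j, k} then \<pi> i else 1)"
      using p_range[of i] by (auto simp: UNIV_bool \<pi>_def)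
  qed
  also have "\<dots> = (if j = k then \<pi> j else \<pi> j * \<pi> k)"
    unfolding prod_jk by simp
  finally show ?thesis .
qed

text \<open>A function of the first \<open>N\<close> data is measurable for the conditioning
  sigma-algebra, so it may be pulled out of the conditional expectation, whose value on
  \<open>E\<close> is the assumed product of probabilities.\<close>

lemma selection_probability:
  fixes r :: "nat \<Rightarrow> nat \<Rightarrow> bool"
  assumes h: "h \<in> borel_measurable (\<Pi>\<^sub>M i\<in>{..<N}. XM \<Otimes>\<^sub>M UM)"
    and int: "integrable M (\<lambda>\<omega>. h (\<lambda>i\<in>{..<N}. W i \<omega>))"
  defines "E \<equiv> {\<omega> \<in> space M. \<forall>i<N. \<forall>j\<in>{1..J}. R i j \<omega> = r i j}"
  shows "E \<in> sets M"
    and "integrable M (\<lambda>\<omega>. h (\<lambda>i\<in>{..<N}. W i \<omega>) * indicator E \<omega>)"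
    and "expectation (\<lambda>\<omega>. h (\<lambda>i\<in>{..<N}. W i \<omega>) * indicator E \<omega>) =
      expectation (\<lambda>\<omega>. h (\<lambda>i\<in>{..<N}. W i \<omega>) * (\<Prod>i<N. pattern_prob (src (W i \<omega>)) (r i)))"
proof -
  let ?W = "\<lambda>\<omega>. \<lambda>i\<in>{..<N}. W i \<omega>"
  let ?P = "\<Pi>\<^sub>M i\<in>{..<N}. XM \<Otimes>\<^sub>M UM"
  let ?F = "vimage_algebra (space M) ?W ?P"
  have Wm: "?W \<in> measurable M ?P" by measurable
  have sub: "subalgebra M ?F"
    using Wm unfolding subalgebra_def measurable_iff_sets by simp
  interpret finite_measure_subalgebra M ?F by unfold_locales (rule sub)
  have R: "{\<omega> \<in> space M. R i j \<omega> = r i j} \<in> sets M" if "j \<in> {1..J}" for i j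
  proof -
    have "R i j -` {r i j} \<inter> space M \<in> sets M"
      by (rule measurable_sets[OF R_measurable[OF that]]) simp
    also have "R i j -` {r i j} \<inter> space M = {\<omega> \<in> space M. R i j \<omega> = r i j}" by auto
    finally show ?thesis .
  qed
  have "E = {\<omega> \<in> space M. \<forall>i\<in>{..<N}. \<forall>j\<in>{1..J}. R i j \<omega> = r i j}" by (auto simp: E_def)
  also have "\<dots> \<in> sets M"
    by (intro sets.sets_Collect_finite_All R) auto
  finally show E: "E \<in> sets M" .
  have "?W \<in> measurable ?F ?P"
    by (rule measurable_vimage_algebra1) (use measurable_space[OF Wm] in auto)
  then have hF: "(\<lambda>\<omega>. h (?W \<omega>)) \<in> borel_measurable ?F"
    using h by (rule measurable_compose)
  show int': "integrable M (\<lambda>\<omega>. h (?W \<omega>) * indicator E \<omega>)"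
    using int E by (intro integrable_real_mult_indicator)
  have "expectation (\<lambda>\<omega>. h (?W \<omega>) * indicator E \<omega>) =
      expectation (\<lambda>\<omega>. h (?W \<omega>) * real_cond_exp M ?F (indicator E) \<omega>)"
    by (rule real_cond_exp_intg(2)[symmetric, OF int' hF]) (use E in simp)
  also have "\<dots> = expectation (\<lambda>\<omega>. h (?W \<omega>) * (\<Prod>i<N. pattern_prob (src (W i \<omega>)) (r i)))"
  proof (rule integral_cong_AE)
    show "AE \<omega> in M. h (?W \<omega>) * real_cond_exp M ?F (indicator E) \<omega> =
        h (?W \<omega>) * (\<Prod>i<N. pattern_prob (src (W i \<omega>)) (r i))"
      using bernoulli_selection[of N r]
    proof eventually_elim
      case (elim \<omega>)
      then show ?case unfolding E_def pattern_prob_src by (simp only:)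
    qed
  qed (use measurable_compose[OF Wm h] in measurable)
  finally show "expectation (\<lambda>\<omega>. h (?W \<omega>) * indicator E \<omega>) =
      expectation (\<lambda>\<omega>. h (?W \<omega>) * (\<Prod>i<N. pattern_prob (src (W i \<omega>)) (r i)))" .
qed

section \<open>Joint expectations over data and selections\<close>

lemma prod_data:
  fixes k :: "nat \<Rightarrow> 'x \<times> 'u \<Rightarrow> real"
  assumes int: "\<And>i. i < N \<Longrightarrow> integrable Pt (k i)"
  shows "integrable M (\<lambda>\<omega>. \<Prod>i<N. k i (W i \<omega>))"
    and "expectation (\<lambda>\<omega>. \<Prod>i<N. k i (W i \<omega>)) = (\<Prod>i<N. \<integral>w. k i w \<partial>Pt)"
proof -
  have m: "k i \<in> borel_measurable (XM \<Otimes>\<^sub>M UM)" if "i < N" for i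
    using borel_measurable_integrable[OF int[OF that]] by (simp cong: measurable_cong_sets add: sets_Pt)
  have indep: "indep_vars (\<lambda>_. borel) (\<lambda>i \<omega>. k i (W i \<omega>)) {..<N}"
    by (rule indep_vars_compose2[OF indep_vars_subset[OF data_indep]]) (auto intro: m)
  have single: "integrable M (\<lambda>\<omega>. k i (W i \<omega>))" "expectation (\<lambda>\<omega>. k i (W i \<omega>)) = (\<integral>w. k i w \<partial>Pt)"
    if "i < N" for i
    using int[OF that] integrable_distr_eq[OF W_measurable[of i] m[OF that]]
      integral_distr[OF W_measurable[of i] m[OF that]] by (simp_all add: data_law)
  show "integrable M (\<lambda>\<omega>. \<Prod>i<N. k i (W i \<omega>))"
    by (rule indep_vars_integrable[OF _ indep]) (auto intro: single)
  have "expectation (\<lambda>\<omega>. \<Prod>i<N. k i (W i \<omega>)) = (\<Prod>i<N. expectation (\<lambda>\<omega>. k i (W i \<omega>)))"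
    by (rule indep_vars_lebesgue_integral[OF _ indep]) (auto intro: single)
  then show "expectation (\<lambda>\<omega>. \<Prod>i<N. k i (W i \<omega>)) = (\<Prod>i<N. \<integral>w. k i w \<partial>Pt)"
    using single by simp
qed

text \<open>On the event that all \<open>N\<close> units show given patterns, the integrand is a
  function of the data alone. Summing over these events and exchanging the sum over joint patterns
  with the product over units yields a product of one-unit integrals, which contains both
  independence and identical distribution.\<close>

lemma prod_data_selection:
  fixes g :: "nat \<Rightarrow> 'x \<times> 'u \<Rightarrow> (nat \<Rightarrow> bool) \<Rightarrow> real"
  assumes int: "\<And>i r. i < N \<Longrightarrow> r \<in> patterns \<Longrightarrow> integrable Pt (\<lambda>w. g i w r)"
  shows "integrable M (\<lambda>\<omega>. \<Prod>i<N. g i (W i \<omega>) (selection i \<omega>))"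
    and "expectation (\<lambda>\<omega>. \<Prod>i<N. g i (W i \<omega>) (selection i \<omega>)) =
      (\<Prod>i<N. \<integral>w. (\<Sum>r\<in>patterns. pattern_prob (src w) r * g i w r) \<partial>Pt)"
proof -
  let ?RR = "PiE {..<N} (\<lambda>_. patterns)"
  define E where "E r = {\<omega> \<in> space M. \<forall>i<N. \<forall>j\<in>{1..J}. R i j \<omega> = r i j}" for r
  define h where "h r x = (\<Prod>i<N. g i (x i) (r i))" for r and x :: "nat \<Rightarrow> 'x \<times> 'u"
  have finRR: "finite ?RR" by (intro finite_PiE) auto
  have hW: "h r (\<lambda>i\<in>{..<N}. W i \<omega>) = (\<Prod>i<N. g i (W i \<omega>) (r i))" for r \<omega>
    unfolding h_def by (intro prod.cong) auto
  have split: "(\<Prod>i<N. g i (W i \<omega>) (selection i \<omega>)) =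
      (\<Sum>r\<in>?RR. h r (\<lambda>i\<in>{..<N}. W i \<omega>) * indicator (E r) \<omega>)" if "\<omega> \<in> space M" for \<omega>
  proof -
    \<comment> \<open>Patterns are extensional, so the realised selections form exactly one element
      of \<open>?RR\<close>, and only its event contains \<open>\<omega>\<close>.\<close>
    define r0 where "r0 = (\<lambda>i\<in>{..<N}. selection i \<omega>)"
    have r0: "r0 \<in> ?RR" unfolding r0_def using selection_in_patterns by auto
    have iff: "\<omega> \<in> E r \<longleftrightarrow> r = r0" if r: "r \<in> ?RR" for r
    proof
      assume "\<omega> \<in> E r"
      then have "r i j = r0 i j" if "i < N" "j \<in> {1..J}" for i j
        using that by (simp add: E_def r0_def selection_def)
      then have "r i = r0 i" if "i < N" for i
        using PiE_ext[of "r i" "{1..J}" "\<lambda>_. UNIV" "r0 i"] that PiE_mem[OF r, of i] PiE_mem[OF r0, of i]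
        by simp
      then show "r = r0" using PiE_ext[OF r r0] by simp
    next
      assume "r = r0"
      then show "\<omega> \<in> E r" using \<open>\<omega> \<in> space M\<close> by (simp add: E_def r0_def selection_def)
    qed
    have "(\<Sum>r\<in>?RR. h r (\<lambda>i\<in>{..<N}. W i \<omega>) * indicator (E r) \<omega>) =
        (\<Sum>r\<in>?RR. if r = r0 then h r (\<lambda>i\<in>{..<N}. W i \<omega>) else 0)"
      by (rule sum.cong[OF refl]) (simp add: indicator_def iff)
    also have "\<dots> = h r0 (\<lambda>i\<in>{..<N}. W i \<omega>)"
      using finRR r0 by (simp add: sum.delta)
    also have "\<dots> = (\<Prod>i<N. g i (W i \<omega>) (selection i \<omega>))"
      unfolding hW by (rule prod.cong) (simp_all add: r0_def)
    finally show ?thesis ..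
  qed
  have int': "integrable Pt (\<lambda>w. pattern_prob (src w) r * g i w r)" if "i < N" "r \<in> patterns" for i r
    by (rule integrable_src_mult[OF int[OF that]])
  have term_r: "integrable M (\<lambda>\<omega>. h r (\<lambda>i\<in>{..<N}. W i \<omega>) * indicator (E r) \<omega>)"
      "expectation (\<lambda>\<omega>. h r (\<lambda>i\<in>{..<N}. W i \<omega>) * indicator (E r) \<omega>) =
        (\<Prod>i<N. \<integral>w. pattern_prob (src w) (r i) * g i w (r i) \<partial>Pt)"
    if r: "r \<in> ?RR" for r
  proof -
    have ri: "r i \<in> patterns" if "i < N" for i using PiE_mem[OF r] that by simp
    have m: "(\<lambda>w. g i w (r i)) \<in> borel_measurable (XM \<Otimes>\<^sub>M UM)" if "i < N" for i
      using borel_measurable_integrable[OF int[OF that ri[OF that]]]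
      by (simp cong: measurable_cong_sets add: sets_Pt)
    have hm: "h r \<in> borel_measurable (\<Pi>\<^sub>M i\<in>{..<N}. XM \<Otimes>\<^sub>M UM)"
      unfolding h_def
    proof (rule borel_measurable_prod)
      fix i assume i: "i \<in> {..<N}"
      show "(\<lambda>x. g i (x i) (r i)) \<in> borel_measurable (\<Pi>\<^sub>M i\<in>{..<N}. XM \<Otimes>\<^sub>M UM)"
        by (rule measurable_compose[OF measurable_component_singleton[OF i] m]) (use i in simp)
    qed
    have hi: "integrable M (\<lambda>\<omega>. h r (\<lambda>i\<in>{..<N}. W i \<omega>))"
      unfolding hW by (rule prod_data) (rule int[OF _ ri])
    note sp = selection_probability(2,3)[OF hm hi, of r, folded E_def]
    show "integrable M (\<lambda>\<omega>. h r (\<lambda>i\<in>{..<N}. W i \<omega>) * indicator (E r) \<omega>)" by (rule sp)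
    have "expectation (\<lambda>\<omega>. h r (\<lambda>i\<in>{..<N}. W i \<omega>) * indicator (E r) \<omega>) =
        expectation (\<lambda>\<omega>. \<Prod>i<N. pattern_prob (src (W i \<omega>)) (r i) * g i (W i \<omega>) (r i))"
      using sp(2) unfolding hW prod.distrib by (simp only: mult.commute)
    also have "\<dots> = (\<Prod>i<N. \<integral>w. pattern_prob (src w) (r i) * g i w (r i) \<partial>Pt)"
      by (rule prod_data) (rule int'[OF _ ri])
    finally show "expectation (\<lambda>\<omega>. h r (\<lambda>i\<in>{..<N}. W i \<omega>) * indicator (E r) \<omega>) =
        (\<Prod>i<N. \<integral>w. pattern_prob (src w) (r i) * g i w (r i) \<partial>Pt)" .
  qed
  have "integrable M (\<lambda>\<omega>. \<Sum>r\<in>?RR. h r (\<lambda>i\<in>{..<N}. W i \<omega>) * indicator (E r) \<omega>)"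
    by (intro Bochner_Integration.integrable_sum term_r)
  also have "?this \<longleftrightarrow> integrable M (\<lambda>\<omega>. \<Prod>i<N. g i (W i \<omega>) (selection i \<omega>))"
    by (intro Bochner_Integration.integrable_cong refl split[symmetric])
  finally show "integrable M (\<lambda>\<omega>. \<Prod>i<N. g i (W i \<omega>) (selection i \<omega>))" .
  have "expectation (\<lambda>\<omega>. \<Prod>i<N. g i (W i \<omega>) (selection i \<omega>)) =
      expectation (\<lambda>\<omega>. \<Sum>r\<in>?RR. h r (\<lambda>i\<in>{..<N}. W i \<omega>) * indicator (E r) \<omega>)"
    by (intro Bochner_Integration.integral_cong refl split)
  also have "\<dots> = (\<Sum>r\<in>?RR. expectation (\<lambda>\<omega>. h r (\<lambda>i\<in>{..<N}. W i \<omega>) * indicator (E r) \<omega>))"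
    by (intro Bochner_Integration.integral_sum term_r)
  also have "\<dots> = (\<Sum>r\<in>?RR. \<Prod>i<N. \<integral>w. pattern_prob (src w) (r i) * g i w (r i) \<partial>Pt)"
    by (intro sum.cong refl term_r)
  also have "\<dots> = (\<Prod>i<N. \<Sum>r\<in>patterns. \<integral>w. pattern_prob (src w) r * g i w r \<partial>Pt)"
    by (rule prod_sum_PiE[symmetric]) (simp, rule finite_patterns)
  also have "\<dots> = (\<Prod>i<N. \<integral>w. (\<Sum>r\<in>patterns. pattern_prob (src w) r * g i w r) \<partial>Pt)"
    by (intro prod.cong refl Bochner_Integration.integral_sum[symmetric] int') auto
  finally show "expectation (\<lambda>\<omega>. \<Prod>i<N. g i (W i \<omega>) (selection i \<omega>)) =
      (\<Prod>i<N. \<integral>w. (\<Sum>r\<in>patterns. pattern_prob (src w) r * g i w r) \<partial>Pt)" .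
qed

lemma unit_expectation:
  fixes g :: "'x \<times> 'u \<Rightarrow> (nat \<Rightarrow> bool) \<Rightarrow> real"
  assumes "\<And>r. r \<in> patterns \<Longrightarrow> integrable Pt (\<lambda>w. g w r)"
  shows "integrable M (\<lambda>\<omega>. g (W 0 \<omega>) (selection 0 \<omega>))"
    and "expectation (\<lambda>\<omega>. g (W 0 \<omega>) (selection 0 \<omega>)) =
      (\<integral>w. (\<Sum>r\<in>patterns. pattern_prob (src w) r * g w r) \<partial>Pt)"
  using prod_data_selection[of "Suc 0" "\<lambda>_. g"] assms by (simp_all add: lessThan_Suc)

lemma selection_measurable: "selection i \<in> measurable M (count_space patterns)"
proof (subst measurable_count_space_eq2[OF finite_patterns], intro conjI ballI)
  show "selection i \<in> space M \<rightarrow> patterns" using selection_in_patterns by auto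
  fix r assume r: "r \<in> patterns"
  have R: "{\<omega> \<in> space M. R i j \<omega> = r j} \<in> sets M" if "j \<in> {1..J}" for j
  proof -
    have "R i j -` {r j} \<inter> space M \<in> sets M"
      by (rule measurable_sets[OF R_measurable[OF that]]) simp
    also have "R i j -` {r j} \<inter> space M = {\<omega> \<in> space M. R i j \<omega> = r j}" by auto
    finally show ?thesis .
  qed
  have "selection i \<omega> = r \<longleftrightarrow> (\<forall>j\<in>{1..J}. R i j \<omega> = r j)" for \<omega>
    using PiE_ext[OF selection_in_patterns r, of i \<omega>] by (auto simp: selection_def)
  then have "selection i -` {r} \<inter> space M = {\<omega> \<in> space M. \<forall>j\<in>{1..J}. R i j \<omega> = r j}" by blast
  also have "\<dots> \<in> sets M" by (intro sets.sets_Collect_finite_All R) auto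
  finally show "selection i -` {r} \<inter> space M \<in> sets M" .
qed

text \<open>Finitely many patterns occur, so measurability for each fixed pattern is enough: the
  composite is glued together along the values of \<open>selection\<close>.\<close>

lemma unit_measurable:
  assumes "\<And>r. r \<in> patterns \<Longrightarrow> (\<lambda>w. y w r) \<in> measurable (XM \<Otimes>\<^sub>M UM) N"
  shows "(\<lambda>\<omega>. y (W i \<omega>) (selection i \<omega>)) \<in> measurable M N"
proof (rule measurable_compose_countable'[where f = "\<lambda>r \<omega>. y (W i \<omega>) r", OF _ selection_measurable])
  show "(\<lambda>\<omega>. y (W i \<omega>) r) \<in> measurable M N" if "r \<in> patterns" for r
    by (rule measurable_compose[OF W_measurable assms[OF that]])
qed (intro countable_finite finite_patterns)

text \<open>The product formula is applied to indicators of Borel sets. The common factor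
  \<open>\<kappa>\<close> does not depend on the unit, which settles the laws and the independence
  together.\<close>

lemma units_iid:
  fixes y :: "'x \<times> 'u \<Rightarrow> (nat \<Rightarrow> bool) \<Rightarrow> 'b::euclidean_space"
  assumes y: "\<And>r. r \<in> patterns \<Longrightarrow> (\<lambda>w. y w r) \<in> borel_measurable (XM \<Otimes>\<^sub>M UM)"
  defines "Y \<equiv> \<lambda>i \<omega>. y (W i \<omega>) (selection i \<omega>)"
  shows "indep_vars (\<lambda>_. borel) Y UNIV" and "distr M borel (Y i) = distr M borel (Y 0)"
proof -
  interpret Pt: prob_space Pt by (rule prob_space_Pt)
  have Ym: "Y i \<in> borel_measurable M" for i
    unfolding Y_def by (rule unit_measurable) (rule y)
  define \<kappa> where "\<kappa> A = (\<integral>w. (\<Sum>r\<in>patterns. pattern_prob (src w) r * indicator A (y w r)) \<partial>Pt)" for A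
  have \<kappa>_UNIV: "\<kappa> UNIV = 1" 
    by (simp only: \<kappa>_def indicator_UNIV mult_1_right sum_pattern_prob) (simp add: Pt.prob_space)
  have joint: "prob (\<Inter>i\<in>I. Y i -` B i \<inter> space M) = (\<Prod>i\<in>I. \<kappa> (B i))"
    if I: "finite I" "I \<noteq> {}" and B: "\<And>i. i \<in> I \<Longrightarrow> B i \<in> sets borel" for I B
  proof -
    \<comment> \<open>The sampling assumption concerns initial segments of units, so
      \<open>I\<close> is enclosed in one; the units added get the set \<open>UNIV\<close>, whose
      factor is one.\<close>
    define N where "N = Suc (Max I)"
    have IN: "I \<subseteq> {..<N}" using Max_ge[OF I(1)] by (auto simp: N_def less_Suc_eq_le)
    define C where "C i = (if i \<in> I then B i else UNIV)" for i
    have C: "C i \<in> sets borel" for i using B by (simp add: C_def)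
    have ind: "(\<Prod>i<N. indicator (C i) (Y i \<omega>)) = (indicator (\<Inter>i\<in>I. Y i -` B i \<inter> space M) \<omega> :: real)"
      if "\<omega> \<in> space M" for \<omega>
    proof (cases "\<forall>i\<in>I. Y i \<omega> \<in> B i")
      case True
      then have "indicator (C i) (Y i \<omega>) = (1::real)" for i by (simp add: C_def)
      then show ?thesis using True that by simp
    next
      case False
      then obtain i where "i \<in> I" "Y i \<omega> \<notin> B i" by blast
      moreover from this IN have "(\<Prod>i<N. indicator (C i) (Y i \<omega>)) = (0::real)"
        by (intro prod_zero bexI[of _ i]) (auto simp: C_def)
      ultimately show ?thesis by (auto simp: indicator_def)
    qed
    have int: "integrable Pt (\<lambda>w. indicator (C i) (y w r) :: real)" if "r \<in> patterns" for i r
    proof (rule Pt.integrable_const_bound[of _ 1])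
      show "(\<lambda>w. indicator (C i) (y w r) :: real) \<in> borel_measurable Pt"
        using measurable_compose[OF y[OF that] borel_measurable_indicator[OF C]]
        by (simp cong: measurable_cong_sets add: sets_Pt)
    qed (simp add: indicator_def)
    have "prob (\<Inter>i\<in>I. Y i -` B i \<inter> space M) = expectation (indicator (\<Inter>i\<in>I. Y i -` B i \<inter> space M))"
    proof -
      have "(\<Inter>i\<in>I. Y i -` B i \<inter> space M) = (\<Inter>i\<in>I. Y i -` B i \<inter> space M) \<inter> space M"
        using I(2) by blast
      then show ?thesis by (simp only: Bochner_Integration.integral_indicator)
    qed
    also have "\<dots> = expectation (\<lambda>\<omega>. \<Prod>i<N. indicator (C i) (Y i \<omega>))"
      by (intro Bochner_Integration.integral_cong refl ind[symmetric])
    also have "\<dots> = (\<Prod>i<N. \<kappa> (C i))"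
      unfolding Y_def \<kappa>_def
      by (rule prod_data_selection(2)[where g = "\<lambda>i w r. indicator (C i) (y w r)"]) (rule int)
    also have "\<dots> = (\<Prod>i\<in>I. \<kappa> (C i))"
      by (rule prod.mono_neutral_right) (use IN \<kappa>_UNIV in \<open>auto simp: C_def\<close>)
    also have "\<dots> = (\<Prod>i\<in>I. \<kappa> (B i))" by (simp add: C_def)
    finally show ?thesis .
  qed
  have law: "prob (Y i -` B \<inter> space M) = \<kappa> B" if "B \<in> sets borel" for i B
    using joint[of "{i}" "\<lambda>_. B"] that by simp
  show "distr M borel (Y i) = distr M borel (Y 0)"
    by (rule measure_eqI) (simp_all add: emeasure_distr[OF Ym] emeasure_eq_measure law)
  show "indep_vars (\<lambda>_. borel) Y UNIV"
    unfolding indep_vars_def2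
  proof (intro conjI ballI indep_setsI)
    show "Y i \<in> borel_measurable M" for i by (rule Ym)
    show "{Y i -` A \<inter> space M |A. A \<in> sets borel} \<subseteq> events" for i
      using measurable_sets[OF Ym] by auto
    fix A and I :: "nat set"
    assume I: "I \<noteq> {}" "finite I" and A: "\<forall>i\<in>I. A i \<in> {Y i -` A \<inter> space M |A. A \<in> sets borel}"
    then have "\<forall>i\<in>I. \<exists>B. B \<in> sets borel \<and> A i = Y i -` B \<inter> space M" by blast
    then obtain B where B: "\<And>i. i \<in> I \<Longrightarrow> B i \<in> sets borel" "\<And>i. i \<in> I \<Longrightarrow> A i = Y i -` B i \<inter> space M"
      by metis
    have "(\<Inter>i\<in>I. A i) = (\<Inter>i\<in>I. Y i -` B i \<inter> space M)" using B by simp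
    then show "prob (\<Inter>i\<in>I. A i) = (\<Prod>i\<in>I. prob (A i))"
      using joint[OF I(2,1) B(1)] B law by simp
  qed
qed

end

section \<open>The asymptotic variance\<close>

lemma weight_function_withD:
  assumes "weight_function_with J Vs c \<rho>" "v \<in> (\<Union>j\<in>{1..J}. Vs j)"
  shows "(\<Sum>j\<in>{1..J}. \<rho> j v) = 1"
    and "j \<in> {1..J} \<Longrightarrow> v \<notin> Vs j \<Longrightarrow> \<rho> j v = 0"
    and "j \<in> {1..J} \<Longrightarrow> sources_of J Vs v = {j} \<Longrightarrow> \<rho> j v = 1"
    and "j \<in> {1..J} \<Longrightarrow> K \<noteq> {} \<Longrightarrow> K \<subseteq> {1..J} - {j} \<Longrightarrow> sources_of J Vs v = insert j K \<Longrightarrow> \<rho> j v = c j K"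
  using assms unfolding weight_function_with_def by blast+

context multisource_bernoulli_sampling
begin

text \<open>\<open>\<alpha> r\<close> is the total inverse-probability weight of a unit with
  selections \<open>r\<close>. Off-diagonal terms of its square average to \<open>x j * x k\<close>
  by independence across sources; a diagonal term averages to the square of \<open>x j\<close> over
  \<open>p j\<close>, whose surplus over the plain square is the origin of
  \<open>od\<close>.\<close>

lemma pattern_moments:
  assumes S: "S \<subseteq> {1..J}" and x: "\<And>j. j \<in> {1..J} - S \<Longrightarrow> x j = 0" "(\<Sum>j\<in>{1..J}. x j) = 1"
  defines "\<alpha> \<equiv> \<lambda>r. \<Sum>j\<in>{1..J}. of_bool (r j) * (x j / (p j * of_bool (j \<in> S)))"
  shows "(\<Sum>r\<in>patterns. pattern_prob S r * \<alpha> r) = 1"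
    and "(\<Sum>r\<in>patterns. pattern_prob S r * (\<alpha> r)\<^sup>2) = 1 + (\<Sum>j\<in>{1..J}. od (p j) * (x j)\<^sup>2)"
proof -
  define \<pi> where "\<pi> j = p j * of_bool (j \<in> S)" for j
  define \<beta> where "\<beta> j = x j / \<pi> j" for j
  have \<alpha>: "\<alpha> r = (\<Sum>j\<in>{1..J}. of_bool (r j) * \<beta> j)" for r
    by (simp only: \<alpha>_def \<beta>_def \<pi>_def)
  \<comment> \<open>Outside \<open>S\<close> the hypothesis \<open>x j = 0\<close> makes the
    identities hold under \<open>0/0 = 0\<close>.\<close>
  have \<beta>\<pi>: "\<beta> j * \<pi> j = x j" and diag: "\<beta> j * \<beta> j * \<pi> j = x j * x j + od (p j) * (x j)\<^sup>2"
    if "j \<in> {1..J}" for j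
    using x(1)[of j] p_range[OF that] that
    by (cases "j \<in> S"; simp add: \<beta>_def \<pi>_def od_def field_simps power2_eq_square)+
  note pair = sum_pattern_prob_pair[OF S, folded \<pi>_def]
  have "(\<Sum>r\<in>patterns. pattern_prob S r * \<alpha> r) =
      (\<Sum>j\<in>{1..J}. \<beta> j * (\<Sum>r\<in>patterns. of_bool (r j) * of_bool (r j) * pattern_prob S r))"
    unfolding \<alpha> sum_distrib_left
    by (subst sum.swap) (intro sum.cong refl, simp add: mult_ac)
  also have "\<dots> = (\<Sum>j\<in>{1..J}. x j)"
    by (intro sum.cong refl) (simp only: pair refl if_True \<beta>\<pi>)
  finally show "(\<Sum>r\<in>patterns. pattern_prob S r * \<alpha> r) = 1" using x(2) by (simp only:)
  have "(\<Sum>r\<in>patterns. pattern_prob S r * (\<alpha> r)\<^sup>2) =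
      (\<Sum>r\<in>patterns. \<Sum>j\<in>{1..J}. \<Sum>k\<in>{1..J}. \<beta> j * \<beta> k * (of_bool (r j) * of_bool (r k) * pattern_prob S r))"
    unfolding \<alpha> power2_eq_square sum_product
    unfolding sum_distrib_left by (intro sum.cong refl) (simp only: mult_ac)
  also have "\<dots> = (\<Sum>j\<in>{1..J}. \<Sum>k\<in>{1..J}. \<Sum>r\<in>patterns.
      \<beta> j * \<beta> k * (of_bool (r j) * of_bool (r k) * pattern_prob S r))"
    by (subst sum.swap, intro sum.cong refl, subst sum.swap, rule refl)
  also have "\<dots> = (\<Sum>j\<in>{1..J}. \<Sum>k\<in>{1..J}. x j * x k + (if j = k then od (p j) * (x j)\<^sup>2 else 0))"
  proof (intro sum.cong refl)
    fix j k assume j: "j \<in> {1..J}" and k: "k \<in> {1..J}"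
    have "(\<Sum>r\<in>patterns. \<beta> j * \<beta> k * (of_bool (r j) * of_bool (r k) * pattern_prob S r)) =
        \<beta> j * \<beta> k * (if j = k then \<pi> j else \<pi> j * \<pi> k)"
      unfolding sum_distrib_left[symmetric] pair[OF j k] ..
    also have "\<dots> = x j * x k + (if j = k then od (p j) * (x j)\<^sup>2 else 0)"
    proof (cases "j = k")
      case True
      then show ?thesis using diag[OF j] by simp
    next
      case False
      have "\<beta> j * \<beta> k * (\<pi> j * \<pi> k) = (\<beta> j * \<pi> j) * (\<beta> k * \<pi> k)" by (simp only: mult_ac)
      then show ?thesis using False \<beta>\<pi>[OF j] \<beta>\<pi>[OF k] by simp
    qed
    finally show "(\<Sum>r\<in>patterns. \<beta> j * \<beta> k * (of_bool (r j) * of_bool (r k) * pattern_prob S r)) =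
        x j * x k + (if j = k then od (p j) * (x j)\<^sup>2 else 0)" .
  qed
  also have "\<dots> = (\<Sum>j\<in>{1..J}. x j) * (\<Sum>k\<in>{1..J}. x k) + (\<Sum>j\<in>{1..J}. od (p j) * (x j)\<^sup>2)"
    unfolding sum_product by (simp add: sum.distrib sum.delta)
  finally show "(\<Sum>r\<in>patterns. pattern_prob S r * (\<alpha> r)\<^sup>2) = 1 + (\<Sum>j\<in>{1..J}. od (p j) * (x j)\<^sup>2)"
    using x(2) by simp
qed

text \<open>On units with a fixed set of sources each weight is 0, 1 or one of the constants. This
  factorisation through \<open>src\<close> is what makes weights measurable on the data.\<close>

lemma weight_function_src:
  assumes "weight_function J Vs \<rho>"
  obtains \<phi> where "\<And>j w. j \<in> {1..J} \<Longrightarrow> w \<in> space (XM \<Otimes>\<^sub>M UM) \<Longrightarrow> \<rho> j (obs coarse w) = \<phi> j (src w)"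
proof -
  obtain c where c: "weight_function_with J Vs c \<rho>" using assms by (auto simp: weight_function_def)
  show thesis
  proof (rule that)
    fix j w assume j: "j \<in> {1..J}" and "w \<in> space (XM \<Otimes>\<^sub>M UM)"
    then have v: "obs coarse w \<in> (\<Union>j\<in>{1..J}. Vs j)" using source_cover by blast
    have src: "src w \<subseteq> {1..J}" "j \<in> src w \<longleftrightarrow> obs coarse w \<in> Vs j"
      using j by (auto simp: src_def sources_of_def)
    have \<rho>: "\<rho> j (obs coarse w) = 0" if "j \<notin> src w"
      using weight_function_withD(2)[OF c v j] that src(2) by blast
    note \<rho>' = weight_function_withD(3)[OF c v j, folded src_def]
    note \<rho>'' = weight_function_withD(4)[OF c v j, folded src_def]
    show "\<rho> j (obs coarse w) =
        (if src w = {j} then 1 else if j \<in> src w then c j (src w - {j}) else 0)"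
    proof (cases "j \<in> src w \<and> src w \<noteq> {j}")
      case True
      then have "src w - {j} \<noteq> {}" "src w - {j} \<subseteq> {1..J} - {j}" "src w = insert j (src w - {j})"
        using src(1) by auto
      from \<rho>''[OF this] True show ?thesis by (simp only: if_True if_False simp_thms)
    next
      case False
      then consider "src w = {j}" | "j \<notin> src w" "src w \<noteq> {j}" by blast
      then show ?thesis
      proof cases
        case 1
        from \<rho>'[OF this] this show ?thesis by simp
      next
        case 2
        from \<rho>[OF this(1)] this show ?thesis by (simp only: if_False)
      qed
    qed
  qed
qed

lemma weight_function_simplex:
  assumes "weight_function J Vs \<rho>" "w \<in> space (XM \<Otimes>\<^sub>M UM)"
  shows "(\<Sum>j\<in>{1..J}. \<rho> j (obs coarse w)) = 1"
    and "\<And>j. j \<in> {1..J} - src w \<Longrightarrow> \<rho> j (obs coarse w) = 0"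
  using assms source_cover[OF assms(2)]
  by (auto simp: weight_function_def weight_function_with_def src_def sources_of_def)

section \<open>Moments of \<open>f\<close> under the data law and the variance formula\<close>

lemma
  fixes f :: "'x \<Rightarrow> real ^ 'k"
  assumes P0: "P0 = distr Pt XM fst"
    and f[measurable]: "f \<in> borel_measurable XM" and f_sq: "integrable P0 (\<lambda>x. (norm (f x))\<^sup>2)"
  shows integrable_data_norm_square: "integrable Pt (\<lambda>w. (norm (f (fst w)))\<^sup>2)"
    and integrable_data: "integrable Pt (\<lambda>w. f (fst w))"
    and integrable_data_component: "integrable Pt (\<lambda>w. f (fst w) $ a)"
    and integrable_data_product: "integrable Pt (\<lambda>w. f (fst w) $ a * f (fst w) $ b)"
    and integral_data: "(\<integral>x. f x \<partial>P0) = (\<integral>w. f (fst w) \<partial>Pt)"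
proof -
  interpret Pt: prob_space Pt by (rule prob_space_Pt)
  have fst_m: "fst \<in> measurable Pt XM" by (simp cong: measurable_cong_sets add: sets_Pt)
  have ff: "(\<lambda>w. f (fst w)) \<in> borel_measurable Pt" by (rule measurable_compose[OF fst_m f])
  show sq: "integrable Pt (\<lambda>w. (norm (f (fst w)))\<^sup>2)"
    using integrable_distr[OF fst_m f_sq[unfolded P0]] .
  show f_int: "integrable Pt (\<lambda>w. f (fst w))"
    by (rule Pt.integrable_norm_square[OF ff sq])
  have fa: "integrable Pt (\<lambda>w. f (fst w) $ a)" for a
    using integrable_inner_right[OF f_int, of "axis a 1"] by (simp add: inner_axis')
  then show "integrable Pt (\<lambda>w. f (fst w) $ a)" .
  show "integrable Pt (\<lambda>w. f (fst w) $ a * f (fst w) $ b)"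
  proof (rule Bochner_Integration.integrable_bound[OF sq])
    show "(\<lambda>w. f (fst w) $ a * f (fst w) $ b) \<in> borel_measurable Pt"
      by (intro borel_measurable_times borel_measurable_integrable[OF fa])
    have "\<bar>f x $ a\<bar> * \<bar>f x $ b\<bar> \<le> norm (f x) * norm (f x)" for x
      by (intro mult_mono component_le_norm_cart) auto
    then show "AE w in Pt. norm (f (fst w) $ a * f (fst w) $ b) \<le> norm ((norm (f (fst w)))\<^sup>2)"
      by (simp add: abs_mult power2_eq_square)
  qed
  show "(\<integral>x. f x \<partial>P0) = (\<integral>w. f (fst w) \<partial>Pt)"
    unfolding P0 by (rule integral_distr[OF fst_m f])
qed

text \<open>The known variance formula in one integral. The summand 1 together with the product of
  means is the covariance of \<open>f\<close> under \<open>P0\<close>. Since \<open>\<rho> j\<close>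
  vanishes outside source \<open>j\<close>, integrating against \<open>Pt\<close> equals the
  conditional expectation given that source times its probability.\<close>

lemma asymptotic_variance_G_HBer:
  fixes f :: "'x \<Rightarrow> real ^ 'k"
  assumes \<rho>: "weight_function J Vs \<rho>" and P0: "P0 = distr Pt XM fst"
    and f[measurable]: "f \<in> borel_measurable XM" and f_sq: "integrable P0 (\<lambda>x. (norm (f x))\<^sup>2)"
  shows "asymptotic_variance M (G_HBer coarse J Vs p P0 W R f \<rho>) =
    (\<chi> a b. (\<integral>w. f (fst w) $ a * f (fst w) $ b * (1 + (\<Sum>j\<in>{1..J}. od (p j) * (\<rho> j (obs coarse w))\<^sup>2)) \<partial>Pt)
      - (\<integral>x. f x \<partial>P0) $ a * (\<integral>x. f x \<partial>P0) $ b)"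
proof -
  interpret Pt: prob_space Pt by (rule prob_space_Pt)
  obtain \<phi> where \<phi>: "\<And>j w. j \<in> {1..J} \<Longrightarrow> w \<in> space (XM \<Otimes>\<^sub>M UM) \<Longrightarrow> \<rho> j (obs coarse w) = \<phi> j (src w)"
    using weight_function_src[OF \<rho>] by blast
  \<comment> \<open>Stated through \<open>\<phi>\<close> rather than \<open>\<rho>\<close>, so that
    the weight of a unit is visibly a function of its selections and of \<open>src\<close>.\<close>
  define \<alpha> where "\<alpha> r S = (\<Sum>j\<in>{1..J}. of_bool (r j) * (\<phi> j S / (p j * of_bool (j \<in> S))))" for r S
  define y where "y w r = \<alpha> r (src w) *\<^sub>R f (fst w)" for w and r :: "nat \<Rightarrow> bool"
  define Y where "Y i \<omega> = y (W i \<omega>) (selection i \<omega>)" for i \<omega>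
  have ff: "(\<lambda>w. f (fst w)) \<in> borel_measurable (XM \<Otimes>\<^sub>M UM)" by measurable
  have y_m: "(\<lambda>w. y w r) \<in> borel_measurable (XM \<Otimes>\<^sub>M UM)" for r
    unfolding y_def by (intro borel_measurable_scaleR src_function_measurable ff)
  have sum_S: "(\<Sum>r\<in>patterns. pattern_prob (src w) r * \<alpha> r (src w)) = 1"
      "(\<Sum>r\<in>patterns. pattern_prob (src w) r * (\<alpha> r (src w))\<^sup>2) =
        1 + (\<Sum>j\<in>{1..J}. od (p j) * (\<rho> j (obs coarse w))\<^sup>2)"
    if w: "w \<in> space (XM \<Otimes>\<^sub>M UM)" for w
  proof -
    have S: "src w \<subseteq> {1..J}" by (auto simp: src_def sources_of_def)
    have 0: "\<phi> j (src w) = 0" if "j \<in> {1..J} - src w" for j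
      using weight_function_simplex(2)[OF \<rho> w that] \<phi>[OF _ w, of j] that by simp
    have 1: "(\<Sum>j\<in>{1..J}. \<phi> j (src w)) = 1"
      using weight_function_simplex(1)[OF \<rho> w] \<phi>[OF _ w] by simp
    show "(\<Sum>r\<in>patterns. pattern_prob (src w) r * \<alpha> r (src w)) = 1"
      unfolding \<alpha>_def by (rule pattern_moments(1)[OF S 0 1])
    have "(\<Sum>r\<in>patterns. pattern_prob (src w) r * (\<alpha> r (src w))\<^sup>2) =
        1 + (\<Sum>j\<in>{1..J}. od (p j) * (\<phi> j (src w))\<^sup>2)"
      unfolding \<alpha>_def by (rule pattern_moments(2)[OF S 0 1])
    also have "(\<Sum>j\<in>{1..J}. od (p j) * (\<phi> j (src w))\<^sup>2) = (\<Sum>j\<in>{1..J}. od (p j) * (\<rho> j (obs coarse w))\<^sup>2)"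
      by (intro sum.cong refl) (simp only: \<phi>[OF _ w])
    finally show "(\<Sum>r\<in>patterns. pattern_prob (src w) r * (\<alpha> r (src w))\<^sup>2) =
        1 + (\<Sum>j\<in>{1..J}. od (p j) * (\<rho> j (obs coarse w))\<^sup>2)" .
  qed
  note sq = integrable_data_norm_square[OF P0 f f_sq] and f_int = integrable_data[OF P0 f f_sq]
    and fa = integrable_data_component[OF P0 f f_sq] and fab = integrable_data_product[OF P0 f f_sq]
    and P0f = integral_data[OF P0 f f_sq]
  have Y_sq: "integrable M (\<lambda>\<omega>. (norm (Y 0 \<omega>))\<^sup>2)"
  proof -
    have "integrable M (\<lambda>\<omega>. (\<alpha> (selection 0 \<omega>) (src (W 0 \<omega>)))\<^sup>2 * (norm (f (fst (W 0 \<omega>))))\<^sup>2)"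
      by (rule unit_expectation(1)[where g = "\<lambda>w r. (\<alpha> r (src w))\<^sup>2 * (norm (f (fst w)))\<^sup>2"])
        (rule integrable_src_mult[OF sq])
    then show ?thesis by (simp add: Y_def y_def power_mult_distrib)
  qed
  have Y_m: "Y i \<in> borel_measurable M" for i
    unfolding Y_def by (rule unit_measurable[OF y_m])
  have Y_int: "integrable M (Y 0)" by (rule integrable_norm_square[OF Y_m Y_sq])
  have mean: "expectation (Y 0) = (\<integral>x. f x \<partial>P0)"
  \<comment> \<open>\<open>unit_expectation\<close> is about real functions, so the mean is computed
    coordinate by coordinate.\<close>
  proof (subst vec_eq_iff, rule allI)
    fix a
    have "expectation (Y 0) $ a = expectation (\<lambda>\<omega>. Y 0 \<omega> $ a)"
      using integral_inner_right[OF Y_int, of "axis a 1"] by (simp add: inner_axis')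
    also have "\<dots> = expectation (\<lambda>\<omega>. \<alpha> (selection 0 \<omega>) (src (W 0 \<omega>)) * f (fst (W 0 \<omega>)) $ a)"
      by (simp add: Y_def y_def)
    also have "\<dots> = (\<integral>w. (\<Sum>r\<in>patterns. pattern_prob (src w) r * (\<alpha> r (src w) * f (fst w) $ a)) \<partial>Pt)"
      by (rule unit_expectation(2)[where g = "\<lambda>w r. \<alpha> r (src w) * f (fst w) $ a"])
        (rule integrable_src_mult[OF fa])
    also have "\<dots> = (\<integral>w. f (fst w) $ a \<partial>Pt)"
    proof (rule Bochner_Integration.integral_cong[OF refl])
      fix w assume "w \<in> space Pt"
      then have w: "w \<in> space (XM \<Otimes>\<^sub>M UM)" by (simp only: space_Pt)
      show "(\<Sum>r\<in>patterns. pattern_prob (src w) r * (\<alpha> r (src w) * f (fst w) $ a)) = f (fst w) $ a"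
        unfolding mult.assoc[symmetric] sum_distrib_right[symmetric] sum_S(1)[OF w] by simp
    qed
    also have "\<dots> = (\<integral>w. f (fst w) \<partial>Pt) $ a"
      using integral_inner_right[OF f_int, of "axis a 1"] by (simp add: inner_axis')
    finally show "expectation (Y 0) $ a = (\<integral>x. f x \<partial>P0) $ a" unfolding P0f .
  qed
  have second: "expectation (\<lambda>\<omega>. Y 0 \<omega> $ a * Y 0 \<omega> $ b) =
      (\<integral>w. f (fst w) $ a * f (fst w) $ b * (1 + (\<Sum>j\<in>{1..J}. od (p j) * (\<rho> j (obs coarse w))\<^sup>2)) \<partial>Pt)" for a b
  proof -
    have "expectation (\<lambda>\<omega>. Y 0 \<omega> $ a * Y 0 \<omega> $ b) =
        expectation (\<lambda>\<omega>. (\<alpha> (selection 0 \<omega>) (src (W 0 \<omega>)))\<^sup>2 * (f (fst (W 0 \<omega>)) $ a * f (fst (W 0 \<omega>)) $ b))"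
      by (intro Bochner_Integration.integral_cong refl) (simp add: Y_def y_def power2_eq_square mult_ac)
    also have "\<dots> = (\<integral>w. (\<Sum>r\<in>patterns. pattern_prob (src w) r * ((\<alpha> r (src w))\<^sup>2 * (f (fst w) $ a * f (fst w) $ b))) \<partial>Pt)"
      by (rule unit_expectation(2)[where g = "\<lambda>w r. (\<alpha> r (src w))\<^sup>2 * (f (fst w) $ a * f (fst w) $ b)"])
        (rule integrable_src_mult[OF fab])
    also have "\<dots> = (\<integral>w. f (fst w) $ a * f (fst w) $ b * (1 + (\<Sum>j\<in>{1..J}. od (p j) * (\<rho> j (obs coarse w))\<^sup>2)) \<partial>Pt)"
    proof (rule Bochner_Integration.integral_cong[OF refl])
      fix w assume "w \<in> space Pt"
      then have w: "w \<in> space (XM \<Otimes>\<^sub>M UM)" by (simp only: space_Pt)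
      have "(\<Sum>r\<in>patterns. pattern_prob (src w) r * ((\<alpha> r (src w))\<^sup>2 * (f (fst w) $ a * f (fst w) $ b))) =
          (\<Sum>r\<in>patterns. pattern_prob (src w) r * (\<alpha> r (src w))\<^sup>2) * (f (fst w) $ a * f (fst w) $ b)"
        by (simp only: mult.assoc[symmetric] sum_distrib_right[symmetric])
      then show "(\<Sum>r\<in>patterns. pattern_prob (src w) r * ((\<alpha> r (src w))\<^sup>2 * (f (fst w) $ a * f (fst w) $ b))) =
          f (fst w) $ a * f (fst w) $ b * (1 + (\<Sum>j\<in>{1..J}. od (p j) * (\<rho> j (obs coarse w))\<^sup>2))"
        unfolding sum_S(2)[OF w] by (simp only: mult.commute)
    qed
    finally show ?thesis .
  qed
  have G: "G_HBer coarse J Vs p P0 W R f \<rho> n \<omega> =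
      sqrt (real n) *\<^sub>R ((1 / real n) *\<^sub>R (\<Sum>i<n. Y i \<omega>) - (\<integral>x. f x \<partial>P0))"
    if \<omega>: "\<omega> \<in> space M" for n \<omega>
  proof -
    have "(\<Sum>j\<in>{1..J}. (of_bool (R i j \<omega>) * \<rho> j (obs coarse (W i \<omega>)) /
            inclusion_prob Vs p j (obs coarse (W i \<omega>))) *\<^sub>R f (fst (W i \<omega>))) = Y i \<omega>" for i
      unfolding Y_def y_def \<alpha>_def scaleR_sum_left
    proof (rule sum.cong[OF refl])
      fix j assume j: "j \<in> {1..J}"
      have "indicator (Vs j) (obs coarse (W i \<omega>)) = (of_bool (j \<in> src (W i \<omega>)) :: real)"
        using j by (simp add: indicator_def src_def sources_of_def)
      moreover have "selection i \<omega> j = R i j \<omega>" using j by (simp add: selection_def)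
      ultimately show "(of_bool (R i j \<omega>) * \<rho> j (obs coarse (W i \<omega>)) /
            inclusion_prob Vs p j (obs coarse (W i \<omega>))) *\<^sub>R f (fst (W i \<omega>)) =
          (of_bool (selection i \<omega> j) * (\<phi> j (src (W i \<omega>)) / (p j * of_bool (j \<in> src (W i \<omega>))))) *\<^sub>R f (fst (W i \<omega>))"
        unfolding inclusion_prob_def by (simp only: \<phi>[OF j W_space[OF \<omega>]] times_divide_eq_right)
    qed
    then show ?thesis unfolding G_HBer_def by simp
  qed
  have iid: "indep_vars (\<lambda>_. borel) Y UNIV" "distr M borel (Y i) = distr M borel (Y 0)" for i
    unfolding Y_def by (rule units_iid[OF y_m])+
  show ?thesis
    using asymptotic_variance_normalized_mean[OF iid Y_sq mean G] unfolding second .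
qed

end

section \<open>Optimal weight functions\<close>

lemma inner_vec_square:
  fixes x v :: "real ^ 'k"
  shows "(x \<bullet> v)\<^sup>2 = (\<Sum>a\<in>UNIV. \<Sum>b\<in>UNIV. x $ a * x $ b * (v $ a * v $ b))"
  by (simp add: inner_vec_def power2_eq_square sum_product mult_ac)

context multisource_bernoulli_sampling
begin

definition optimal_rho :: "nat \<Rightarrow> 'c \<times> 'u \<Rightarrow> real"
  where "optimal_rho j v = (if j \<in> sources_of J Vs v then optimal_weight p (sources_of J Vs v) j else 0)"

lemma sources_of_facts:
  shows "finite (sources_of J Vs v)" "sources_of J Vs v \<subseteq> {1..J}"
    and "\<forall>j\<in>sources_of J Vs v. 0 < p j \<and> p j \<le> 1"
    and "v \<in> (\<Union>j\<in>{1..J}. Vs j) \<Longrightarrow> sources_of J Vs v \<noteq> {}"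
  using p_range by (auto simp: sources_of_def)

lemma sum_over_sources:
  fixes g :: "nat \<Rightarrow> real"
  assumes "\<And>j. j \<in> {1..J} \<Longrightarrow> v \<notin> Vs j \<Longrightarrow> g j = 0"
  shows "(\<Sum>j\<in>{1..J}. g j) = (\<Sum>j\<in>sources_of J Vs v. g j)"
  by (rule sum.mono_neutral_right) (use assms in \<open>auto simp: sources_of_def\<close>)

lemma weight_function_optimal_rho:
  "weight_function_with J Vs (\<lambda>j K. optimal_weight p (insert j K) j) optimal_rho"
  unfolding weight_function_with_def
proof (intro ballI conjI impI allI)
  fix v assume "v \<in> (\<Union>j\<in>{1..J}. Vs j)"
  note S = sources_of_facts(1)[of v] sources_of_facts(4)[OF this] sources_of_facts(3)[of v]
  note sum = optimal_weight_sum[OF S]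
  show "0 \<le> optimal_rho j v" "optimal_rho j v \<le> 1" for j
    using optimal_weight_nonneg[OF S] optimal_weight_le_1[OF S]
    by (simp_all add: optimal_rho_def)
  have "(\<Sum>j\<in>{1..J}. optimal_rho j v) = (\<Sum>j\<in>sources_of J Vs v. optimal_rho j v)"
    by (rule sum_over_sources) (simp add: optimal_rho_def sources_of_def)
  then show "(\<Sum>j\<in>{1..J}. optimal_rho j v) = 1" using sum by (simp add: optimal_rho_def)
  fix j
  show "optimal_rho j v = 0" if "v \<notin> Vs j" using that by (simp add: optimal_rho_def sources_of_def)
  show "optimal_rho j v = 1" if "sources_of J Vs v = {j}" using that sum by (simp add: optimal_rho_def)
  show "optimal_rho j v = optimal_weight p (insert j K) j"
    if "K \<noteq> {} \<and> K \<subseteq> {1..J} - {j} \<and> sources_of J Vs v = insert j K" for K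
    using that by (simp add: optimal_rho_def)
qed

definition excess :: "(nat \<Rightarrow> 'c \<times> 'u \<Rightarrow> real) \<Rightarrow> 'x \<times> 'u \<Rightarrow> real"
  where "excess \<rho> w = (\<Sum>j\<in>{1..J}. od (p j) * (\<rho> j (obs coarse w) - optimal_rho j (obs coarse w))\<^sup>2)"

lemma od_p_nonneg: "j \<in> {1..J} \<Longrightarrow> 0 \<le> od (p j)"
  using p_range[of j] by (intro od_nonneg) auto

lemma excess_nonneg: "0 \<le> excess \<rho> w"
  unfolding excess_def by (intro sum_nonneg mult_nonneg_nonneg od_p_nonneg) auto

text \<open>A source with \<open>p j = 1\<close> enters with coefficient
  \<open>od (p j) = 0\<close>; this is why its weights stay free.\<close>

lemma excess_eq_0_iff:
  "excess \<rho> w = 0 \<longleftrightarrow> (\<forall>j\<in>{1..J}. p j < 1 \<longrightarrow> \<rho> j (obs coarse w) = optimal_rho j (obs coarse w))"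
proof -
  have "excess \<rho> w = 0 \<longleftrightarrow>
      (\<forall>j\<in>{1..J}. od (p j) * (\<rho> j (obs coarse w) - optimal_rho j (obs coarse w))\<^sup>2 = 0)"
    unfolding excess_def by (rule sum_nonneg_eq_0_iff) (auto intro!: mult_nonneg_nonneg od_p_nonneg)
  also have "\<dots> \<longleftrightarrow> (\<forall>j\<in>{1..J}. p j < 1 \<longrightarrow> \<rho> j (obs coarse w) = optimal_rho j (obs coarse w))"
  proof (intro ball_cong refl)
    fix j assume "j \<in> {1..J}"
    then have "0 < p j" "p j \<le> 1" using p_range by auto
    then have "od (p j) = 0 \<longleftrightarrow> \<not> p j < 1" by (auto simp: od_def)
    then show "(od (p j) * (\<rho> j (obs coarse w) - optimal_rho j (obs coarse w))\<^sup>2 = 0) =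
        (p j < 1 \<longrightarrow> \<rho> j (obs coarse w) = optimal_rho j (obs coarse w))" by auto
  qed
  finally show ?thesis .
qed

lemma variance_density_excess:
  assumes \<rho>: "weight_function J Vs \<rho>" and w: "w \<in> space (XM \<Otimes>\<^sub>M UM)"
  shows "(\<Sum>j\<in>{1..J}. od (p j) * (\<rho> j (obs coarse w))\<^sup>2) =
    (\<Sum>j\<in>{1..J}. od (p j) * (optimal_rho j (obs coarse w))\<^sup>2) + excess \<rho> w"
proof -
  let ?v = "obs coarse w"
  note S = sources_of_facts(1)[of ?v] sources_of_facts(4)[OF source_cover[OF w]] sources_of_facts(3)[of ?v]
  have 0: "\<rho> j ?v = 0" "optimal_rho j ?v = 0" if "j \<in> {1..J}" "?v \<notin> Vs j" for j
    using weight_function_simplex(2)[OF \<rho> w, of j] that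
    by (auto simp: src_def optimal_rho_def sources_of_def)
  have sum1: "(\<Sum>j\<in>sources_of J Vs ?v. \<rho> j ?v) = 1"
    using weight_function_simplex(1)[OF \<rho> w] sum_over_sources[of ?v "\<lambda>j. \<rho> j ?v"] 0 by simp
  have o: "optimal_rho j ?v = optimal_weight p (sources_of J Vs ?v) j" if "j \<in> sources_of J Vs ?v" for j
    using that by (simp add: optimal_rho_def)
  have "(\<Sum>j\<in>{1..J}. od (p j) * (\<rho> j ?v)\<^sup>2) = (\<Sum>j\<in>sources_of J Vs ?v. od (p j) * (\<rho> j ?v)\<^sup>2)"
    by (rule sum_over_sources) (simp add: 0)
  also have "\<dots> = (\<Sum>j\<in>sources_of J Vs ?v. od (p j) * (optimal_rho j ?v)\<^sup>2) +
      (\<Sum>j\<in>sources_of J Vs ?v. od (p j) * (\<rho> j ?v - optimal_rho j ?v)\<^sup>2)"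
    using weighted_square_excess[OF S sum1] o by simp
  also have "(\<Sum>j\<in>sources_of J Vs ?v. od (p j) * (optimal_rho j ?v)\<^sup>2) = (\<Sum>j\<in>{1..J}. od (p j) * (optimal_rho j ?v)\<^sup>2)"
    by (rule sum_over_sources[symmetric]) (simp add: 0)
  also have "(\<Sum>j\<in>sources_of J Vs ?v. od (p j) * (\<rho> j ?v - optimal_rho j ?v)\<^sup>2) = excess \<rho> w"
    unfolding excess_def by (rule sum_over_sources[symmetric]) (simp add: 0)
  finally show ?thesis .
qed

lemma integrable_mult_weight_density:
  assumes \<rho>: "weight_function J Vs \<rho>" and g: "integrable Pt g"
  shows "integrable Pt (\<lambda>w. g w * (\<Sum>j\<in>{1..J}. od (p j) * (\<rho> j (obs coarse w))\<^sup>2))"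
proof -
  obtain \<phi> where \<phi>: "\<And>j w. j \<in> {1..J} \<Longrightarrow> w \<in> space (XM \<Otimes>\<^sub>M UM) \<Longrightarrow> \<rho> j (obs coarse w) = \<phi> j (src w)"
    using weight_function_src[OF \<rho>] by blast
  have "integrable Pt (\<lambda>w. (\<Sum>j\<in>{1..J}. od (p j) * (\<phi> j (src w))\<^sup>2) * g w)"
    by (rule integrable_src_mult[OF g])
  also have "?this \<longleftrightarrow> integrable Pt (\<lambda>w. g w * (\<Sum>j\<in>{1..J}. od (p j) * (\<rho> j (obs coarse w))\<^sup>2))"
    by (intro Bochner_Integration.integrable_cong refl) (simp add: space_Pt \<phi> mult.commute)
  finally show ?thesis .
qed

section \<open>Comparison in the positive semidefinite order\<close>

context
  fixes f :: "'x \<Rightarrow> real ^ 'k" and P0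
  assumes P0: "P0 = distr Pt XM fst"
    and f: "f \<in> borel_measurable XM" and f_sq: "integrable P0 (\<lambda>x. (norm (f x))\<^sup>2)"
begin

lemma integrable_inner_square: "integrable Pt (\<lambda>w. (x \<bullet> f (fst w))\<^sup>2)"
  unfolding inner_vec_square
  by (intro Bochner_Integration.integrable_sum integrable_mult_right integrable_data_product[OF P0 f f_sq])

text \<open>The products of means are the same for all weight functions and cancel, and so does the
  pointwise minimum of the density. What remains is the difference of excesses, and the quadratic
  form at \<open>x\<close> turns \<open>f\<close> times its transpose into the square of
  \<open>x \<bullet> f\<close>.\<close>

lemma psd_le_asymptotic_variance_iff:
  assumes \<rho>: "weight_function J Vs \<rho>" and \<rho>': "weight_function J Vs \<rho>'"
  shows "psd_le (asymptotic_variance M (G_HBer coarse J Vs p P0 W R f \<rho>))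
      (asymptotic_variance M (G_HBer coarse J Vs p P0 W R f \<rho>')) \<longleftrightarrow>
    (\<forall>x. 0 \<le> (\<integral>w. (x \<bullet> f (fst w))\<^sup>2 * (excess \<rho>' w - excess \<rho> w) \<partial>Pt))"
proof -
  let ?D = "\<lambda>\<rho> w. \<Sum>j\<in>{1..J}. od (p j) * (\<rho> j (obs coarse w))\<^sup>2"
  let ?m = "\<integral>x. f x \<partial>P0"
  let ?V = "\<lambda>\<rho>. asymptotic_variance M (G_HBer coarse J Vs p P0 W R f \<rho>)"
  note V = asymptotic_variance_G_HBer[OF _ P0 f f_sq]
  note fab = integrable_data_product[OF P0 f f_sq]
  have entry: "(?V \<rho>' - ?V \<rho>) $ a $ b = (\<integral>w. f (fst w) $ a * f (fst w) $ b * (?D \<rho>' w - ?D \<rho> w) \<partial>Pt)" for a b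
    using integrable_mult_weight_density[OF \<rho> fab[of a b]] integrable_mult_weight_density[OF \<rho>' fab[of a b]]
      fab[of a b]
    unfolding V[OF \<rho>] V[OF \<rho>'] by (simp add: distrib_left right_diff_distrib)
  have int: "integrable Pt (\<lambda>w. f (fst w) $ a * f (fst w) $ b * (?D \<rho>' w - ?D \<rho> w))" for a b
    using integrable_mult_weight_density[OF \<rho> fab[of a b]] integrable_mult_weight_density[OF \<rho>' fab[of a b]]
    by (simp add: right_diff_distrib)
  have "x \<bullet> ((?V \<rho>' - ?V \<rho>) *v x) = (\<integral>w. (x \<bullet> f (fst w))\<^sup>2 * (excess \<rho>' w - excess \<rho> w) \<partial>Pt)" for x
  proof -
    have "x \<bullet> ((?V \<rho>' - ?V \<rho>) *v x) =
        (\<Sum>a\<in>UNIV. \<Sum>b\<in>UNIV. x $ a * x $ b * (?V \<rho>' - ?V \<rho>) $ a $ b)"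
      unfolding inner_vec_def matrix_vector_mult_def
      by (simp add: sum_distrib_left mult_ac del: vector_minus_component)
    also have "\<dots> = (\<integral>w. (\<Sum>a\<in>UNIV. \<Sum>b\<in>UNIV. x $ a * x $ b *
        (f (fst w) $ a * f (fst w) $ b * (?D \<rho>' w - ?D \<rho> w))) \<partial>Pt)"
      unfolding entry using int by (simp add: Bochner_Integration.integral_sum)
    also have "\<dots> = (\<integral>w. (x \<bullet> f (fst w))\<^sup>2 * (excess \<rho>' w - excess \<rho> w) \<partial>Pt)"
    proof (rule Bochner_Integration.integral_cong[OF refl])
      fix w assume "w \<in> space Pt"
      then have "?D \<rho>' w - ?D \<rho> w = excess \<rho>' w - excess \<rho> w"
        using variance_density_excess[OF \<rho>] variance_density_excess[OF \<rho>'] by (simp add: space_Pt)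
      then show "(\<Sum>a\<in>UNIV. \<Sum>b\<in>UNIV. x $ a * x $ b *
          (f (fst w) $ a * f (fst w) $ b * (?D \<rho>' w - ?D \<rho> w))) =
          (x \<bullet> f (fst w))\<^sup>2 * (excess \<rho>' w - excess \<rho> w)"
        unfolding inner_vec_square by (simp only: sum_distrib_right mult.assoc)
    qed
    finally show ?thesis .
  qed
  moreover have "transpose (?V \<rho>' - ?V \<rho>) = ?V \<rho>' - ?V \<rho>"
    unfolding transpose_def vec_eq_iff vec_lambda_beta entry by (simp add: mult.commute)
  ultimately show ?thesis unfolding psd_le_def psd_def by simp
qed

lemma integrable_excess:
  assumes "weight_function J Vs \<rho>"
  shows "integrable Pt (\<lambda>w. (x \<bullet> f (fst w))\<^sup>2 * excess \<rho> w)"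
proof -
  have opt: "weight_function J Vs optimal_rho"
    using weight_function_optimal_rho by (auto simp: weight_function_def)
  have "integrable Pt (\<lambda>w. (x \<bullet> f (fst w))\<^sup>2 * (\<Sum>j\<in>{1..J}. od (p j) * (\<rho> j (obs coarse w))\<^sup>2) -
      (x \<bullet> f (fst w))\<^sup>2 * (\<Sum>j\<in>{1..J}. od (p j) * (optimal_rho j (obs coarse w))\<^sup>2))"
    by (intro Bochner_Integration.integrable_diff integrable_mult_weight_density assms opt integrable_inner_square)
  also have "?this \<longleftrightarrow> integrable Pt (\<lambda>w. (x \<bullet> f (fst w))\<^sup>2 * excess \<rho> w)"
    by (intro Bochner_Integration.integrable_cong refl)
      (simp only: variance_density_excess[OF assms] space_Pt distrib_left add_diff_cancel_left')
  finally show ?thesis .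
qed

lemma excess_optimal_rho: "excess optimal_rho w = 0"
  by (simp add: excess_def)

text \<open>A minimiser must in particular beat \<open>optimal_rho\<close>, whose excess is zero, so
  a nonnegative function has nonpositive integral. Conversely, where \<open>f\<close> does not
  vanish the excess of \<open>\<rho>\<close> is zero, and that of a competitor is
  nonnegative.\<close>

lemma minimizes_iff_excess:
  "minimizes_asymptotic_variance M J Vs (G_HBer coarse J Vs p P0 W R f) \<rho> \<longleftrightarrow>
    weight_function J Vs \<rho> \<and> (AE w in Pt. f (fst w) = 0 \<or> excess \<rho> w = 0)"
proof safe
  have opt: "weight_function J Vs optimal_rho"
    using weight_function_optimal_rho by (auto simp: weight_function_def)
  assume min: "minimizes_asymptotic_variance M J Vs (G_HBer coarse J Vs p P0 W R f) \<rho>"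
  then show \<rho>: "weight_function J Vs \<rho>" by (simp add: minimizes_asymptotic_variance_def)
  have le: "0 \<le> (\<integral>w. (x \<bullet> f (fst w))\<^sup>2 * (excess optimal_rho w - excess \<rho> w) \<partial>Pt)" for x
    using min opt psd_le_asymptotic_variance_iff[OF \<rho> opt]
    unfolding minimizes_asymptotic_variance_def by blast
  \<comment> \<open>Coordinate directions suffice: they are finitely many, so their null sets can be
    united, and \<open>f\<close> vanishes once all its coordinates do.\<close>
  have "AE w in Pt. (axis a 1 \<bullet> f (fst w))\<^sup>2 * excess \<rho> w = 0" for a
  proof -
    note i = integrable_excess[OF \<rho>, of "axis a 1"]
    have nn: "0 \<le> (axis a 1 \<bullet> f (fst w))\<^sup>2 * excess \<rho> w" for w
      by (intro mult_nonneg_nonneg excess_nonneg) simp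
    have "(\<integral>w. (axis a 1 \<bullet> f (fst w))\<^sup>2 * excess \<rho> w \<partial>Pt) \<le> 0"
      using le[of "axis a 1"] by (simp add: excess_optimal_rho)
    then have "(\<integral>w. (axis a 1 \<bullet> f (fst w))\<^sup>2 * excess \<rho> w \<partial>Pt) = 0"
      by (rule antisym) (rule Bochner_Integration.integral_nonneg, rule nn)
    then show ?thesis
      by (subst (asm) integral_nonneg_eq_0_iff_AE[OF i]) (use nn in auto)
  qed
  then have "AE w in Pt. \<forall>a\<in>UNIV. (axis a 1 \<bullet> f (fst w))\<^sup>2 * excess \<rho> w = 0"
    by (intro AE_finite_allI) auto
  then show "AE w in Pt. f (fst w) = 0 \<or> excess \<rho> w = 0"
    by eventually_elim (auto simp: vec_eq_iff inner_axis')
next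
  assume \<rho>: "weight_function J Vs \<rho>" and ae: "AE w in Pt. f (fst w) = 0 \<or> excess \<rho> w = 0"
  have "psd_le (asymptotic_variance M (G_HBer coarse J Vs p P0 W R f \<rho>))
      (asymptotic_variance M (G_HBer coarse J Vs p P0 W R f \<rho>'))" if \<rho>': "weight_function J Vs \<rho>'" for \<rho>'
    unfolding psd_le_asymptotic_variance_iff[OF \<rho> \<rho>']
  proof
    fix x
    have "AE w in Pt. 0 \<le> (x \<bullet> f (fst w))\<^sup>2 * (excess \<rho>' w - excess \<rho> w)"
      using ae
    proof eventually_elim
      case (elim w)
      then show ?case using excess_nonneg[of \<rho>' w] by (elim disjE) simp_all
    qed
    then show "0 \<le> (\<integral>w. (x \<bullet> f (fst w))\<^sup>2 * (excess \<rho>' w - excess \<rho> w) \<partial>Pt)"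
      by (rule integral_nonneg_AE)
  qed
  with \<rho> show "minimizes_asymptotic_variance M J Vs (G_HBer coarse J Vs p P0 W R f) \<rho>"
    by (simp add: minimizes_asymptotic_variance_def)
qed

text \<open>The constants are not random, so a single data point in the overlap decides an equation
  between them. This extracts such a point from the almost sure statement.\<close>

lemma relevant_overlap_witness:
  assumes "relevant_overlap coarse J Vs Pt f S"
    and "AE w in Pt. Q w"
  obtains w where "w \<in> space (XM \<Otimes>\<^sub>M UM)" "sources_of J Vs (obs coarse w) = S" "f (fst w) \<noteq> 0" "Q w"
proof (rule ccontr)
  assume none: "\<not> thesis"
  have "AE w in Pt. sources_of J Vs (obs coarse w) = S \<longrightarrow> f (fst w) = 0"
    using assms(2) AE_space
    by eventually_elim (use none that in \<open>auto simp: space_Pt\<close>)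
  with assms(1) show False by (simp add: relevant_overlap_def)
qed

text \<open>On units with a fixed set of sources the excess depends on the constants alone, so
  vanishing almost surely becomes a finite system of equations, one family per relevant
  overlap.\<close>

lemma minimizes_iff_constants:
  assumes c: "weight_function_with J Vs c \<rho>"
  shows "minimizes_asymptotic_variance M J Vs (G_HBer coarse J Vs p P0 W R f) \<rho> \<longleftrightarrow>
    (\<forall>j\<in>{1..J}. \<forall>K. K \<noteq> {} \<and> K \<subseteq> {1..J} - {j} \<and> relevant_overlap coarse J Vs Pt f (insert j K) \<longrightarrow>
      p j < 1 \<longrightarrow> c j K = optimal_weight p (insert j K) j)"
proof -
  have \<rho>: "weight_function J Vs \<rho>" using c by (auto simp: weight_function_def)
  have val: "\<rho> j (obs coarse w) = c j K" "optimal_rho j (obs coarse w) = optimal_weight p (insert j K) j"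
    if "j \<in> {1..J}" "w \<in> space (XM \<Otimes>\<^sub>M UM)" "K \<noteq> {}" "K \<subseteq> {1..J} - {j}"
      "sources_of J Vs (obs coarse w) = insert j K" for j w K
    using weight_function_withD(4)[OF c source_cover[OF that(2)] that(1,3-5)]
      weight_function_withD(4)[OF weight_function_optimal_rho source_cover[OF that(2)] that(1,3-5)] by simp_all
  show ?thesis
    unfolding minimizes_iff_excess
  proof (intro iffI conjI \<rho> ballI allI impI; (elim conjE)?)
    fix j K
    assume ae: "AE w in Pt. f (fst w) = 0 \<or> excess \<rho> w = 0" and j: "j \<in> {1..J}" and K: "K \<noteq> {}" "K \<subseteq> {1..J} - {j}"
      and rel: "relevant_overlap coarse J Vs Pt f (insert j K)" and "p j < 1"
    obtain w where w: "w \<in> space (XM \<Otimes>\<^sub>M UM)" "sources_of J Vs (obs coarse w) = insert j K"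
      and "f (fst w) \<noteq> 0" "f (fst w) = 0 \<or> excess \<rho> w = 0"
      using relevant_overlap_witness[OF rel ae] by blast
    then have "excess \<rho> w = 0" by blast
    then have "\<rho> j (obs coarse w) = optimal_rho j (obs coarse w)"
      unfolding excess_eq_0_iff using j \<open>p j < 1\<close> by blast
    then show "c j K = optimal_weight p (insert j K) j"
      unfolding val[OF j w(1) K w(2)] .
  next
    assume cond: "\<forall>j\<in>{1..J}. \<forall>K. K \<noteq> {} \<and> K \<subseteq> {1..J} - {j} \<and> relevant_overlap coarse J Vs Pt f (insert j K) \<longrightarrow>
      p j < 1 \<longrightarrow> c j K = optimal_weight p (insert j K) j"
    have "AE w in Pt. sources_of J Vs (obs coarse w) = S \<longrightarrow> f (fst w) = 0 \<or> excess \<rho> w = 0" for S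
    proof (cases "relevant_overlap coarse J Vs Pt f S")
      case False
      then have "AE w in Pt. sources_of J Vs (obs coarse w) = S \<longrightarrow> f (fst w) = 0"
        by (simp add: relevant_overlap_def)
      then show ?thesis by eventually_elim auto
    next
      case True
      show ?thesis
        using AE_space
      proof eventually_elim
        case (elim w)
        then have w: "w \<in> space (XM \<Otimes>\<^sub>M UM)" by (simp only: space_Pt)
        have "excess \<rho> w = 0" if S: "sources_of J Vs (obs coarse w) = S"
          unfolding excess_eq_0_iff
        proof (intro ballI impI)
          fix j assume j: "j \<in> {1..J}" and lt: "p j < 1"
          \<comment> \<open>In the first two cases every weight function takes the same forced
            value, 0 or 1; only the third involves a constant.\<close>
          consider "j \<notin> S" | "S = {j}" | "j \<in> S" "S - {j} \<noteq> {}" by blast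
          then show "\<rho> j (obs coarse w) = optimal_rho j (obs coarse w)"
          proof cases
            case 1
            then have "obs coarse w \<notin> Vs j" using j S by (auto simp: sources_of_def)
            then show ?thesis
              using weight_function_withD(2)[OF c source_cover[OF w] j]
                weight_function_withD(2)[OF weight_function_optimal_rho source_cover[OF w] j] by simp
          next
            case 2
            then show ?thesis
              using weight_function_withD(3)[OF c source_cover[OF w] j]
                weight_function_withD(3)[OF weight_function_optimal_rho source_cover[OF w] j] S by simp
          next
            case 3
            have K: "S - {j} \<subseteq> {1..J} - {j}" "insert j (S - {j}) = S"
              using S 3 by (auto simp: sources_of_def)
            have "c j (S - {j}) = optimal_weight p (insert j (S - {j})) j"
              using cond[rule_format, OF j _ lt, of "S - {j}"] 3(2) K True by simp
            then show ?thesis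
              using val[OF j w 3(2) K(1)] S K(2) by (simp only:)
          qed
        qed
        then show ?case by blast
      qed
    qed
    then have "AE w in Pt. \<forall>S\<in>Pow {1..J}. sources_of J Vs (obs coarse w) = S \<longrightarrow> f (fst w) = 0 \<or> excess \<rho> w = 0"
      by (intro AE_finite_allI) auto
    then show "AE w in Pt. f (fst w) = 0 \<or> excess \<rho> w = 0"
      by eventually_elim (use sources_of_facts(2) in blast)
  qed
qed

end

end

text \<open>For two and for several sources there is an existence claim, with the constants
  prescribed on all index sets, and a criterion for any weight function. The criterion is confined
  to relevant overlaps, since elsewhere \<open>f\<close> vanishes almost surely and the constants do
  not affect the variance. In the general case arbitrariness for \<open>p j = 1\<close> is expressed
  by imposing no equation; the sum constraint is part of
  \<open>weight_function_with\<close>.\<close>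

theorem proposition3p1:
  fixes M :: "'s measure"
    and XM :: "'x measure" and UM :: "'u measure" and CM :: "'c measure"
    and coarse :: "'x \<Rightarrow> 'c"
    and J :: nat and Vs :: "nat \<Rightarrow> ('c \<times> 'u) set"
    and Pt :: "('x \<times> 'u) measure" and P0 :: "'x measure"
    and p :: "nat \<Rightarrow> real"
    and W :: "nat \<Rightarrow> 's \<Rightarrow> 'x \<times> 'u"
    and R :: "nat \<Rightarrow> nat \<Rightarrow> 's \<Rightarrow> bool"
    and f :: "'x \<Rightarrow> real ^ 'k"
    and optimal :: "(nat \<Rightarrow> 'c \<times> 'u \<Rightarrow> real) \<Rightarrow> bool"
  assumes sampling: "multisource_bernoulli_sampling M XM UM CM coarse J Vs Pt p W R"
    and P0: "P0 = distr Pt XM fst"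
    and f_measurable: "f \<in> borel_measurable XM"
    and f_square_integrable: "integrable P0 (\<lambda>x. (norm (f x))\<^sup>2)"
    and optimal: "optimal = minimizes_asymptotic_variance M J Vs (G_HBer coarse J Vs p P0 W R f)"
  shows
    "(J = 2 \<and> od (p 1) + od (p 2) > 0 \<longrightarrow>
       (\<exists>\<rho> c. weight_function_with J Vs c \<rho> \<and> optimal \<rho> \<and>
          c 1 {2} = od (p 2) / (od (p 1) + od (p 2)) \<and>
          c 2 {1} = od (p 1) / (od (p 1) + od (p 2))) \<and>
       (\<forall>\<rho> c. weight_function_with J Vs c \<rho> \<longrightarrow>
          (optimal \<rho> \<longleftrightarrow>
            (relevant_overlap coarse J Vs Pt f {1, 2} \<longrightarrow>
              c 1 {2} = od (p 2) / (od (p 1) + od (p 2)) \<and>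
              c 2 {1} = od (p 1) / (od (p 1) + od (p 2))))))
     \<and>
     (J \<ge> 2 \<longrightarrow>
       (\<exists>\<rho> c. weight_function_with J Vs c \<rho> \<and> optimal \<rho> \<and>
          (\<forall>j\<in>{1..J}. \<forall>K. K \<noteq> {} \<and> K \<subseteq> {1..J} - {j} \<longrightarrow>
            (p j < 1 \<and> (\<exists>k\<in>K. p k = 1) \<longrightarrow> c j K = 0) \<and>
            (p j < 1 \<and> (\<forall>k\<in>K. p k < 1) \<longrightarrow>
              c j K = (\<Prod>k\<in>K. od (p k)) /
                ((\<Prod>k\<in>K. od (p k)) + od (p j) * (\<Sum>n\<in>K. (\<Prod>k\<in>K. od (p k)) / od (p n)))))) \<and>
       (\<forall>\<rho> c. weight_function_with J Vs c \<rho> \<longrightarrow>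
          (optimal \<rho> \<longleftrightarrow>
            (\<forall>j\<in>{1..J}. \<forall>K. K \<noteq> {} \<and> K \<subseteq> {1..J} - {j} \<and>
                relevant_overlap coarse J Vs Pt f (insert j K) \<longrightarrow>
              (p j < 1 \<and> (\<exists>k\<in>K. p k = 1) \<longrightarrow> c j K = 0) \<and>
              (p j < 1 \<and> (\<forall>k\<in>K. p k < 1) \<longrightarrow>
                c j K = (\<Prod>k\<in>K. od (p k)) /
                  ((\<Prod>k\<in>K. od (p k)) + od (p j) * (\<Sum>n\<in>K. (\<Prod>k\<in>K. od (p k)) / od (p n))))))))"
proof -
  interpret multisource_bernoulli_sampling M XM UM CM coarse J Vs Pt p W R by (rule sampling)
  define c0 where "c0 = (\<lambda>j K. optimal_weight p (insert j K) j)"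
  have c0: "weight_function_with J Vs c0 optimal_rho"
    unfolding c0_def by (rule weight_function_optimal_rho)
  have criterion: "optimal \<rho> \<longleftrightarrow>
      (\<forall>j\<in>{1..J}. \<forall>K. K \<noteq> {} \<and> K \<subseteq> {1..J} - {j} \<and> relevant_overlap coarse J Vs Pt f (insert j K) \<longrightarrow>
        p j < 1 \<longrightarrow> c j K = optimal_weight p (insert j K) j)"
    if "weight_function_with J Vs c \<rho>" for c \<rho>
    unfolding optimal by (rule minimizes_iff_constants[OF P0 f_measurable f_square_integrable that])
  have opt0: "optimal optimal_rho" unfolding criterion[OF c0] by (simp add: c0_def)
  have formula: "(p j < 1 \<and> (\<exists>k\<in>K. p k = 1) \<longrightarrow> c = 0) \<and>
      (p j < 1 \<and> (\<forall>k\<in>K. p k < 1) \<longrightarrow> c = (\<Prod>k\<in>K. od (p k)) /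
        ((\<Prod>k\<in>K. od (p k)) + od (p j) * (\<Sum>n\<in>K. (\<Prod>k\<in>K. od (p k)) / od (p n)))) \<longleftrightarrow>
    (p j < 1 \<longrightarrow> c = optimal_weight p (insert j K) j)"
    if "j \<in> {1..J}" "K \<subseteq> {1..J} - {j}" for j K c
  proof (rule optimal_weight_iff)
    show "finite K" using that(2) by (rule finite_subset) simp
    show "j \<notin> K" using that(2) by blast
    show "\<forall>k\<in>insert j K. 0 < p k \<and> p k \<le> 1" using that p_range by blast
  qed
  have two: "(\<exists>\<rho> c. weight_function_with J Vs c \<rho> \<and> optimal \<rho> \<and>
          c 1 {2} = od (p 2) / (od (p 1) + od (p 2)) \<and>
          c 2 {1} = od (p 1) / (od (p 1) + od (p 2))) \<and>
       (\<forall>\<rho> c. weight_function_with J Vs c \<rho> \<longrightarrow>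
          (optimal \<rho> \<longleftrightarrow>
            (relevant_overlap coarse J Vs Pt f {1, 2} \<longrightarrow>
              c 1 {2} = od (p 2) / (od (p 1) + od (p 2)) \<and>
              c 2 {1} = od (p 1) / (od (p 1) + od (p 2)))))"
    if J: "J = 2" and pos: "od (p 1) + od (p 2) > 0"
  proof -
    have p12: "0 < p 1" "p 1 \<le> 1" "0 < p 2" "p 2 \<le> 1" using p_range[of 1] p_range[of 2] J by auto
    note pair = optimal_weight_pair[OF p12 pos]
    have comm: "{2, 1} = {1, 2::nat}" by blast
    have set12: "{1..J} = {1, 2}" using J by auto
    have sub: "K \<noteq> {} \<and> K \<subseteq> {1, 2} - {1::nat} \<longleftrightarrow> K = {2}" "K \<noteq> {} \<and> K \<subseteq> {1, 2} - {2::nat} \<longleftrightarrow> K = {1}" for K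
      by auto
    have all: "(\<forall>K. K \<noteq> {} \<and> K \<subseteq> {1, 2} - {1} \<and> P K \<longrightarrow> Q K) \<longleftrightarrow> (P {2} \<longrightarrow> Q {2})"
        "(\<forall>K. K \<noteq> {} \<and> K \<subseteq> {1, 2} - {2} \<and> P K \<longrightarrow> Q K) \<longleftrightarrow> (P {1} \<longrightarrow> Q {1})"
      for P Q :: "nat set \<Rightarrow> bool" unfolding conj_assoc[symmetric] sub by blast+
    have ball: "(\<forall>j\<in>{1, 2::nat}. F j) \<longleftrightarrow> F 1 \<and> F 2" for F by blast
    \<comment> \<open>If both sources were fully sampled, both odds would be zero, against
      \<open>pos\<close>. So the criterion supplies at least one of the two equations.\<close>
    have not_one: "p 1 < 1 \<or> p 2 < 1"
    proof (rule ccontr)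
      assume "\<not> (p 1 < 1 \<or> p 2 < 1)"
      then have "p 1 = 1" "p 2 = 1" using p12 by linarith+
      then show False using pos by (simp add: od_one)
    qed
    \<comment> \<open>The criterion yields an equation only where \<open>p j < 1\<close>; since both
      pairs sum to one, one equation implies the other.\<close>
    have either: "(A \<longrightarrow> x = u) \<and> (B \<longrightarrow> y = v) \<longleftrightarrow> x = u \<and> y = v"
      if "A \<or> B" "x + y = 1" "u + v = 1" for A B and x y u v :: real
      using that by (cases A; cases B) auto
    have "optimal \<rho> \<longleftrightarrow>
        (relevant_overlap coarse J Vs Pt f {1, 2} \<longrightarrow>
          c 1 {2} = od (p 2) / (od (p 1) + od (p 2)) \<and>
          c 2 {1} = od (p 1) / (od (p 1) + od (p 2)))" if c: "weight_function_with J Vs c \<rho>" for \<rho> c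
    proof -
      have "optimal \<rho> \<longleftrightarrow> (relevant_overlap coarse J Vs Pt f {1, 2} \<longrightarrow>
          (p 1 < 1 \<longrightarrow> c 1 {2} = optimal_weight p {1, 2} 1) \<and>
          (p 2 < 1 \<longrightarrow> c 2 {1} = optimal_weight p {1, 2} 2))"
        unfolding criterion[OF c] set12 ball all comm by blast
      moreover have "(p 1 < 1 \<longrightarrow> c 1 {2} = optimal_weight p {1, 2} 1) \<and>
          (p 2 < 1 \<longrightarrow> c 2 {1} = optimal_weight p {1, 2} 2) \<longleftrightarrow>
          c 1 {2} = od (p 2) / (od (p 1) + od (p 2)) \<and> c 2 {1} = od (p 1) / (od (p 1) + od (p 2))"
        if rel: "relevant_overlap coarse J Vs Pt f {1, 2}"
      proof -
        \<comment> \<open>Nothing ties the two constants together if the overlap is empty. Relevance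
          provides a point in it, where the weights, and hence the constants, sum to one.\<close>
        have ae: "AE w in Pt. True" by simp
        obtain w where w: "w \<in> space (XM \<Otimes>\<^sub>M UM)" "sources_of J Vs (obs coarse w) = {1, 2}"
          by (rule relevant_overlap_witness[OF P0 f_measurable f_square_integrable rel ae])
        have v: "obs coarse w \<in> (\<Union>j\<in>{1..J}. Vs j)" by (rule source_cover[OF w(1)])
        have "\<rho> 1 (obs coarse w) = c 1 {2}" "\<rho> 2 (obs coarse w) = c 2 {1}"
          by (rule weight_function_withD(4)[OF c v]; use w(2) set12 comm in auto)+
        moreover have "\<rho> 1 (obs coarse w) + \<rho> 2 (obs coarse w) = 1"
          using weight_function_withD(1)[OF c v] unfolding set12 by simp
        ultimately have "c 1 {2} + c 2 {1} = 1" by simp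
        moreover have "optimal_weight p {1, 2} 1 + optimal_weight p {1, 2} 2 = 1"
          unfolding pair using pos by (simp add: add_divide_distrib[symmetric] add.commute)
        ultimately show ?thesis unfolding pair[symmetric] by (rule either[OF not_one])
      qed
      ultimately show ?thesis by blast
    qed
    moreover have "c0 1 {2} = od (p 2) / (od (p 1) + od (p 2))" "c0 2 {1} = od (p 1) / (od (p 1) + od (p 2))"
      unfolding c0_def comm pair by (rule refl)+
    ultimately show ?thesis using c0 opt0 by blast
  qed
  have existence: "(\<exists>\<rho> c. weight_function_with J Vs c \<rho> \<and> optimal \<rho> \<and>
          (\<forall>j\<in>{1..J}. \<forall>K. K \<noteq> {} \<and> K \<subseteq> {1..J} - {j} \<longrightarrow>
            (p j < 1 \<and> (\<exists>k\<in>K. p k = 1) \<longrightarrow> c j K = 0) \<and>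
            (p j < 1 \<and> (\<forall>k\<in>K. p k < 1) \<longrightarrow>
              c j K = (\<Prod>k\<in>K. od (p k)) /
                ((\<Prod>k\<in>K. od (p k)) + od (p j) * (\<Sum>n\<in>K. (\<Prod>k\<in>K. od (p k)) / od (p n))))))"
    using formula c0 opt0 by (intro exI[of _ optimal_rho] exI[of _ c0]) (simp add: c0_def)
  have characterization: "optimal \<rho> \<longleftrightarrow>
            (\<forall>j\<in>{1..J}. \<forall>K. K \<noteq> {} \<and> K \<subseteq> {1..J} - {j} \<and>
                relevant_overlap coarse J Vs Pt f (insert j K) \<longrightarrow>
              (p j < 1 \<and> (\<exists>k\<in>K. p k = 1) \<longrightarrow> c j K = 0) \<and>
              (p j < 1 \<and> (\<forall>k\<in>K. p k < 1) \<longrightarrow>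
                c j K = (\<Prod>k\<in>K. od (p k)) /
                  ((\<Prod>k\<in>K. od (p k)) + od (p j) * (\<Sum>n\<in>K. (\<Prod>k\<in>K. od (p k)) / od (p n)))))"
    if c: "weight_function_with J Vs c \<rho>" for \<rho> c
    unfolding criterion[OF c]
  proof (intro ball_cong refl all_cong1 imp_cong)
    fix j K
    assume "j \<in> {1..J}"
      and "K \<noteq> {} \<and> K \<subseteq> {1..J} - {j} \<and> relevant_overlap coarse J Vs Pt f (insert j K)"
    then show "(p j < 1 \<longrightarrow> c j K = optimal_weight p (insert j K) j) \<longleftrightarrow>
        (p j < 1 \<and> (\<exists>k\<in>K. p k = 1) \<longrightarrow> c j K = 0) \<and>
        (p j < 1 \<and> (\<forall>k\<in>K. p k < 1) \<longrightarrow> c j K = (\<Prod>k\<in>K. od (p k)) /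
          ((\<Prod>k\<in>K. od (p k)) + od (p j) * (\<Sum>n\<in>K. (\<Prod>k\<in>K. od (p k)) / od (p n))))"
      using formula[of j K "c j K"] by (intro sym[OF formula]) auto
  qed
  show ?thesis
    by (intro conjI[OF impI impI], erule conjE, rule two, assumption+)
      (intro conjI[OF existence] allI impI characterization)
qed

end
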